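(* Let $\beta\in\mathbb R_+^V$ and $u_{o,\cdot}=(u_{o,x})_{x\in V}\in\mathbb R^V$ with $u_{o,o}=0$ satisfy $\beta_x=\frac12\sum_{y\in V}C_{xy}e^{u_{o,y}-u_{o,x}}$ for all $x\in V$, and assume that the Markov jump process with law $Q^G_{o,\beta}$ is transient (a.s. every vertex is visited at most finitely often). Then there exists a unique measure $\hat\nu_\beta$ on $(\hat W^*,\hat{\mathcal W}^* )$ such that for any finite $\emptyset\ne K\subseteq V$ one has $$1_{\hat W_K^*}\hat\nu_\beta=\pi^*[\hat Q_{K,\beta}].$$ It is $\sigma$-finite and it is given by $$\hat\nu_\beta(A)=\sup_{\emptyset\neq K\subset V\text{ finite}}\pi^*[\hat Q_{K,\beta}](A)\quad\text{for all }A\in\hat{\mathcal W}^*.$$ The measure $\hat\nu_\beta$ is not the measure zero: for all finite $\emptyset\neq K\subset V$ one has $$0<\hat\nu_\beta(\hat W^*_K)=\pi^*[\hat Q_{K,\beta}](\hat W_K^* )<\infty.$$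
   Context: $\mathbb N=\{1,2,\dots\}$, $\mathbb N_0=\mathbb N\cup\{0\}$, $\mathbb R_+=(0,\infty)$. $G=(V,E)$ is an infinite, locally finite, connected undirected graph without direct loops, with conductances $C_{xy}=C_{yx}>0$ on edges $\{x,y\}\in E$ and $C_{xy}=0$ if $\{x,y\}\notin E$. A vertex $o\in V$ is fixed. For $z\in V$, $Q^G_{z,\beta}$ is the law on $V^{\mathbb N_0}\times\mathbb R_+^{\mathbb N_0}$ (canonical process $\hat w=(w,l)$) of the Markov jump process on $G$ started at $z$ with jump rates $\frac12C_{xy}e^{u_{o,y}-u_{o,x}}$ from $x$ to $y$: $w(0)=z$ and, conditionally on $(w(k'))_{k'\le k},(l(k'))_{k'<k}$ with $w(k)=x$, one has $w(k+1)=y$ with probability $C_{xy}e^{u_{o,y}}/\sum_{v}C_{xv}e^{u_{o,v}}$ and, independently, $l(k)$ is exponential with parameter $\beta_x$. For $I\subseteq\mathbb Z$, $W(I)$ is the set of all $(w(k))_{k\in I}\in V^I$ with $\{w(k),w(k+1)\}\in E$ whenever $\{k,k+1\}\subseteq I$ and $|\{k\in I:w(k)=j\}|<\infty$ for all $j\in V$. $\hat W(I)=W(I)\times\mathbb R_+^I$, with natural $\sigma$-field $\hat{\mathcal W}(I)$ and elements $\hat w=(w,l)$. $\hat W^\to=\hat W(\mathbb N_0)$, $\hat W=\hat W(\mathbb Z)$, $\hat{\mathcal W}=\hat{\mathcal W}(\mathbb Z)$. By transience the laws $Q^G_{x,\beta}$ are regarded as laws on $\hat W^\to$. For finite $\emptyset\ne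 K\subseteq V$ let $A_K=\{\hat w\in\hat W^\to: w(0)\in K\text{ and }w(k)\notin K\text{ for all }k>0\}$. $\hat Q_{K,\beta}$ is the unique finite measure on $(\hat W,\hat{\mathcal W})$ such that for all $x\in V$, $\ell\ge0$, $B_1,B_2\in\hat{\mathcal W}(\mathbb N)$ $$\hat Q_{K,\beta}[(\hat w(-n))_{n\in\mathbb N}\in B_1,\,w(0)=x,\,l(0)\ge\ell,\,\hat w|_{\mathbb N}\in B_2]=\beta_xe^{-\ell\beta_x}e^{2u_{o,x}}Q^G_{x,\beta}[\hat w|_{\mathbb N}\in B_1,\hat w|_{\mathbb N_0}\in A_K]\,Q^G_{x,\beta}[\hat w|_{\mathbb N}\in B_2].$$ $\hat W^*=\hat W/\!\sim$, where $\hat w\sim\hat w'$ iff there is $m\in\mathbb Z$ with $\hat w(k)=\hat w'(k+m)$ for all $k\in\mathbb Z$; $\pi^*:\hat W\to\hat W^*$ is the canonical map; $\hat{\mathcal W}^*=\{A\subseteq\hat W^*:(\pi^* )^{-1}[A]\in\hat{\mathcal W}\}$ is the $\sigma$-field generated by $\pi^*$; $\pi^*[\mu]$ denotes the image measure of $\mu$ under $\pi^*$. $\hat W_K^*=\pi^*[\{(w,l)\in\hat W:w(0)\in K\}]$, and $1_{A}\nu$ denotes the measure $\nu(\cdot\cap A)$. *)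

theory Defs
  imports "HOL-Probability.Probability"
begin

text \<open>The vertex set is the whole type \<open>'v\<close>; countability of \<open>'v\<close> is not assumed, it follows
  from local finiteness and connectedness.\<close>

definition conductance_graph :: "'v set set \<Rightarrow> ('v \<Rightarrow> 'v \<Rightarrow> real) \<Rightarrow> bool" where
  "conductance_graph E C \<longleftrightarrow>
     infinite (UNIV :: 'v set) \<and>
     (\<forall>e\<in>E. \<exists>x y. x \<noteq> y \<and> e = {x, y}) \<and>
     (\<forall>x. finite {y. {x, y} \<in> E}) \<and>
     (\<forall>x y. (x, y) \<in> {(a, b). {a, b} \<in> E}\<^sup>*) \<and>
     (\<forall>x y. C x y = C y x) \<and>
     (\<forall>x y. {x, y} \<in> E \<longrightarrow> C x y > 0) \<and>
     (\<forall>x y. {x, y} \<notin> E \<longrightarrow> C x y = 0)"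

section \<open>Path spaces\<close>

text \<open>Paths with time set \<open>I\<close> are pairs \<open>(w, l)\<close> of functions that are extensional on \<open>I\<close>.
  The sets of positive and of nonnegative integers are \<open>{1..}\<close> and \<open>{0..}\<close>, of type \<^typ>\<open>int set\<close>.\<close>

type_synonym 'v path = "(int \<Rightarrow> 'v) \<times> (int \<Rightarrow> real)"

text \<open>\<open>V\<^sup>I \<times> \<real>\<^sub>+\<^sup>J\<close>; different time sets for the two components
  are needed to express conditioning on \<open>w(0), \<dots>, w(k), l(0), \<dots>, l(k-1)\<close>.\<close>

definition prod_space :: "int set \<Rightarrow> int set \<Rightarrow> 'v path measure" where
  "prod_space I J =
     PiM I (\<lambda>_. count_space UNIV) \<Otimes>\<^sub>M PiM J (\<lambda>_. restrict_space borel {0<..})"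

definition restrict_path :: "int set \<Rightarrow> int set \<Rightarrow> 'v path \<Rightarrow> 'v path" where
  "restrict_path I J = (\<lambda>(w, l). (restrict w I, restrict l J))"

definition W :: "'v set set \<Rightarrow> int set \<Rightarrow> (int \<Rightarrow> 'v) set" where
  "W E I = {w \<in> extensional I.
     (\<forall>k. {k, k + 1} \<subseteq> I \<longrightarrow> {w k, w (k + 1)} \<in> E) \<and>
     (\<forall>j. finite {k \<in> I. w k = j})}"

definition hatW :: "'v set set \<Rightarrow> int set \<Rightarrow> 'v path set" where
  "hatW E I = W E I \<times> (I \<rightarrow>\<^sub>E {0<..})"

definition hatW_space :: "'v set set \<Rightarrow> int set \<Rightarrow> 'v path measure" where
  "hatW_space E I = restrict_space (prod_space I I) (hatW E I)"

section \<open>The Markov jump process\<close>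

text \<open>The last conjunct is the conditional law of \<open>(w(k+1), l(k))\<close> given
  \<open>w(0), \<dots>, w(k), l(0), \<dots>, l(k-1)\<close>: conditional probabilities are characterized by integration
  over the events \<open>H\<close> of this past, and the countably many values \<open>x\<close> of \<open>w(k)\<close> are treated
  separately. The holding time is conditionally independent of \<open>w(k+1)\<close>, hence the product.\<close>

definition is_jump_law ::
  "('v \<Rightarrow> 'v \<Rightarrow> real) \<Rightarrow> ('v \<Rightarrow> real) \<Rightarrow> ('v \<Rightarrow> real) \<Rightarrow> 'v \<Rightarrow> 'v path measure \<Rightarrow> bool" where
  "is_jump_law C u \<beta> z Q \<longleftrightarrow>
     prob_space Q \<and> sets Q = sets (prod_space {0..} {0..}) \<and>
     (AE (w, l) in Q. w 0 = z) \<and>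
     (\<forall>k\<ge>0. \<forall>H\<in>sets (prod_space {0..k} {0..<k}). \<forall>x y. \<forall>B\<in>sets borel.
        measure Q {(w, l) \<in> space Q. restrict_path {0..k} {0..<k} (w, l) \<in> H \<and>
                                     w k = x \<and> w (k + 1) = y \<and> l k \<in> B} =
        measure Q {(w, l) \<in> space Q. restrict_path {0..k} {0..<k} (w, l) \<in> H \<and> w k = x}
        * (C x y * exp (u y) / (\<Sum>\<^sub>\<infinity>v\<in>UNIV. C x v * exp (u v)))
        * measure (density lborel (exponential_density (\<beta> x))) B)"

definition jump_law ::
  "('v \<Rightarrow> 'v \<Rightarrow> real) \<Rightarrow> ('v \<Rightarrow> real) \<Rightarrow> ('v \<Rightarrow> real) \<Rightarrow> 'v \<Rightarrow> 'v path measure" where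
  "jump_law C u \<beta> z = (THE Q. is_jump_law C u \<beta> z Q)"

definition transient_law :: "'v path measure \<Rightarrow> bool" where
  "transient_law Q \<longleftrightarrow> (AE (w, l) in Q. \<forall>x. finite {k. k \<ge> 0 \<and> w k = x})"

text \<open>In the transient case the jump law is concentrated on \<open>hatW E {0..}\<close> and is regarded as a law
  on that set.\<close>

definition hat_jump_law ::
  "'v set set \<Rightarrow> ('v \<Rightarrow> 'v \<Rightarrow> real) \<Rightarrow> ('v \<Rightarrow> real) \<Rightarrow> ('v \<Rightarrow> real) \<Rightarrow> 'v \<Rightarrow> 'v path measure" where
  "hat_jump_law E C u \<beta> x = restrict_space (jump_law C u \<beta> x) (hatW E {0..})"

section \<open>The measures on two-sided paths\<close>

definition escape_set :: "'v set set \<Rightarrow> 'v set \<Rightarrow> 'v path set" where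
  "escape_set E K = {(w, l) \<in> hatW E {0..}. w 0 \<in> K \<and> (\<forall>k>0. w k \<notin> K)}"

definition past :: "'v path \<Rightarrow> 'v path" where
  "past = (\<lambda>(w, l). (\<lambda>n\<in>{1..}. w (- n), \<lambda>n\<in>{1..}. l (- n)))"

definition future :: "'v path \<Rightarrow> 'v path" where
  "future = restrict_path {1..} {1..}"

definition is_hatQ ::
  "'v set set \<Rightarrow> ('v \<Rightarrow> 'v \<Rightarrow> real) \<Rightarrow> ('v \<Rightarrow> real) \<Rightarrow> ('v \<Rightarrow> real) \<Rightarrow> 'v set \<Rightarrow> 'v path measure \<Rightarrow> bool"
where
  "is_hatQ E C u \<beta> K M \<longleftrightarrow>
     finite_measure M \<and> sets M = sets (hatW_space E UNIV) \<and>
     (\<forall>x. \<forall>a\<ge>0. \<forall>B1\<in>sets (hatW_space E {1..}). \<forall>B2\<in>sets (hatW_space E {1..}).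
        measure M {(w, l) \<in> space M. past (w, l) \<in> B1 \<and> w 0 = x \<and> l 0 \<ge> a \<and> future (w, l) \<in> B2} =
        \<beta> x * exp (- a * \<beta> x) * exp (2 * u x)
        * measure (hat_jump_law E C u \<beta> x)
            {h \<in> space (hat_jump_law E C u \<beta> x). future h \<in> B1 \<and> h \<in> escape_set E K}
        * measure (hat_jump_law E C u \<beta> x)
            {h \<in> space (hat_jump_law E C u \<beta> x). future h \<in> B2})"

definition hatQ ::
  "'v set set \<Rightarrow> ('v \<Rightarrow> 'v \<Rightarrow> real) \<Rightarrow> ('v \<Rightarrow> real) \<Rightarrow> ('v \<Rightarrow> real) \<Rightarrow> 'v set \<Rightarrow> 'v path measure" where
  "hatQ E C u \<beta> K = (THE M. is_hatQ E C u \<beta> K M)"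

section \<open>Paths modulo time shift\<close>

definition shift_rel :: "'v set set \<Rightarrow> ('v path \<times> 'v path) set" where
  "shift_rel E = {((w, l), (w', l')). (w, l) \<in> hatW E UNIV \<and> (w', l') \<in> hatW E UNIV \<and>
     (\<exists>m. \<forall>k. (w k, l k) = (w' (k + m), l' (k + m)))}"

definition hatW_star :: "'v set set \<Rightarrow> 'v path set set" where
  "hatW_star E = hatW E UNIV // shift_rel E"

definition proj_star :: "'v set set \<Rightarrow> 'v path \<Rightarrow> 'v path set" where
  "proj_star E h = shift_rel E `` {h}"

definition hatW_star_space :: "'v set set \<Rightarrow> 'v path set measure" where
  "hatW_star_space E = sigma (hatW_star E)
     {A. A \<subseteq> hatW_star E \<and> proj_star E -` A \<inter> hatW E UNIV \<in> sets (hatW_space E UNIV)}"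

definition hatW_star_K :: "'v set set \<Rightarrow> 'v set \<Rightarrow> 'v path set set" where
  "hatW_star_K E K = proj_star E ` {(w, l) \<in> hatW E UNIV. w 0 \<in> K}"

abbreviation image_hatQ ::
  "'v set set \<Rightarrow> ('v \<Rightarrow> 'v \<Rightarrow> real) \<Rightarrow> ('v \<Rightarrow> real) \<Rightarrow> ('v \<Rightarrow> real) \<Rightarrow> 'v set \<Rightarrow> 'v path set measure"
where
  "image_hatQ E C u \<beta> K \<equiv> distr (hatQ E C u \<beta> K) (hatW_star_space E) (proj_star E)"

text \<open>The generating family of \<^const>\<open>hatW_star_space\<close> is already a \<open>\<sigma>\<close>-algebra.\<close>

lemma space_prod_space: "space (prod_space I J) = extensional I \<times> (J \<rightarrow>\<^sub>E {0<..})"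
  by (auto simp: prod_space_def space_pair_measure space_PiM space_restrict_space PiE_def)

lemma space_hatW_space [simp]: "space (hatW_space E I) = hatW E I"
  by (auto simp: hatW_space_def space_restrict_space space_prod_space hatW_def W_def)

lemma space_hatW_star_space [simp]: "space (hatW_star_space E) = hatW_star E"
  by (auto simp: hatW_star_space_def intro!: space_measure_of)

lemma sets_hatW_star_space:
  "sets (hatW_star_space E) =
     {A. A \<subseteq> hatW_star E \<and> proj_star E -` A \<inter> hatW E UNIV \<in> sets (hatW_space E UNIV)}"
    (is "_ = ?S")
proof -
  let ?f = "proj_star E" and ?\<Omega> = "hatW E UNIV" and ?M = "hatW_space E UNIV"
  have f: "?f \<in> ?\<Omega> \<rightarrow> hatW_star E"
    by (auto simp: proj_star_def hatW_star_def quotient_def)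
  have "sigma_algebra (hatW_star E) ?S"
    unfolding sigma_algebra_iff2
  proof (intro conjI ballI allI impI)
    show "?S \<subseteq> Pow (hatW_star E)" by auto
    show "{} \<in> ?S" by simp
  next
    fix A assume A: "A \<in> ?S"
    have "?f -` (hatW_star E - A) \<inter> ?\<Omega> = space ?M - (?f -` A \<inter> ?\<Omega>)"
      using f by auto
    with A show "hatW_star E - A \<in> ?S" by (auto simp del: space_hatW_space)
  next
    fix A :: "nat \<Rightarrow> _" assume A: "range A \<subseteq> ?S"
    have "?f -` (\<Union>i. A i) \<inter> ?\<Omega> = (\<Union>i. ?f -` A i \<inter> ?\<Omega>)" by auto
    moreover have "\<dots> \<in> sets ?M" using A by (intro sets.countable_UN) auto
    ultimately show "(\<Union>i. A i) \<in> ?S" using A by auto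
  qed
  then show ?thesis
    unfolding hatW_star_space_def by (rule sigma_algebra.sets_measure_of_eq)
qed

end

theory Submission imports Defs begin

text \<open>
The key to the statement is a single shift-invariant measure on two-sided paths, of which every
\<open>hatQ K\<close> is a restriction. Put \<open>c x = \<beta> x * exp (2 * u x)\<close> and let \<open>mu\<close> be the measure that chooses
\<open>w(0) = x\<close> with weight \<open>c x\<close> and then runs two independent copies of the jump process from \<open>x\<close>, one
as the future and one as the past. The jump chain has transition probabilities
\<open>p x y = C x y * exp (u y) / (2 * \<beta> x * exp (u x))\<close>, so \<open>c x * p x y = C x y * exp (u x + u y) / 2\<close> is
symmetric in \<open>x\<close> and \<open>y\<close>. This detailed balance makes \<open>mu\<close> invariant under time shifts (\<open>mu_shift\<close>).

The defining formula of \<open>hatQ K\<close> says that a path enters \<open>K\<close> for the first time at time 0: its past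
is required to avoid \<open>K\<close>. Hence \<open>hatQ K\<close> is \<open>mu\<close> restricted to the set \<open>entry K\<close> of these paths
(\<open>hatQ_eq_entrance_measure\<close>); the factor \<open>\<beta> x * exp (- a * \<beta> x)\<close> is \<open>\<beta> x\<close> times the tail of the
exponential holding time at time 0, which is independent of the future.

Paths in \<open>hatW\<close> visit each vertex finitely often, so a path that visits the finite set \<open>K\<close> has exactly
one shift in \<open>entry K\<close>. For two measurable sets \<open>D1\<close>, \<open>D2\<close> that meet each shift orbit at most once,
and for a shift-invariant set \<open>A\<close>, summation over the time that separates the visits to \<open>D1\<close> and
\<open>D2\<close> shows that \<open>mu\<close> gives the same mass to the part of \<open>D1 \<inter> A\<close> whose orbits meet \<open>D2\<close> as to the
part of \<open>D2 \<inter> A\<close> whose orbits meet \<open>D1\<close> (\<open>section_transfer\<close>). This is the whole consistency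
argument: take a measurable set \<open>least_visit\<close> that meets every orbit exactly once and let \<open>nu\<close> be the
image of \<open>mu\<close> restricted to it; the choice \<open>D1 = least_visit\<close>, \<open>D2 = entry K\<close> gives the required
restriction of \<open>nu\<close> for every finite \<open>K\<close> at once (\<open>density_nu\<close>).

Uniqueness, the supremum formula and \<open>\<sigma>\<close>-finiteness follow by exhausting the countable vertex set by
finite sets. Positivity rests on transience, which spreads from one starting point to all others
by connectedness: a transient path leaves \<open>K\<close> for the last time at some time, so that from some
vertex of \<open>K\<close> the process has a positive probability never to return.

Both \<open>jump_law\<close> and \<open>hatQ\<close> are definite descriptions, so their existence and uniqueness are proved as
well. Uniqueness is a matter of \<open>\<pi>\<close>-systems. For existence, the jump process is realised on a
product space with an independent instruction (next vertex, holding time) for each pair of a step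
number and a vertex.
\<close>

section \<open>Cylinder sets\<close>

lemma measurable_vertex [measurable]:
  assumes "k \<in> I" shows "(\<lambda>h. fst h k) \<in> measurable (prod_space I J) (count_space UNIV)"
  unfolding prod_space_def
  by (rule measurable_compose[OF measurable_fst]) (use assms in measurable)

lemma measurable_time [measurable]:
  assumes "k \<in> J" shows "(\<lambda>h. snd h k) \<in> borel_measurable (prod_space I J)"
proof -
  have "(\<lambda>h. snd h k) \<in> measurable (prod_space I J) (restrict_space borel {0<..})"
    unfolding prod_space_def
    by (rule measurable_compose[OF measurable_snd]) (use assms in measurable)
  then show ?thesis unfolding measurable_restrict_space2_iff by blast
qed

lemma measurable_into_prod_space:
  assumes "f \<in> space M \<rightarrow> space (prod_space I J)"
    and "\<And>k. k \<in> I \<Longrightarrow> (\<lambda>x. fst (f x) k) \<in> measurable M (count_space UNIV)"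
    and "\<And>k. k \<in> J \<Longrightarrow> (\<lambda>x. snd (f x) k) \<in> borel_measurable M"
  shows "f \<in> measurable M (prod_space I J)"
proof -
  have sp: "\<And>x. x \<in> space M \<Longrightarrow> fst (f x) \<in> extensional I"
      "\<And>x. x \<in> space M \<Longrightarrow> snd (f x) \<in> J \<rightarrow>\<^sub>E {0<..}"
    using assms(1) by (simp_all add: space_prod_space Pi_iff mem_Times_iff)
  have "(\<lambda>x. fst (f x)) \<in> measurable M (PiM I (\<lambda>_. count_space UNIV))"
    using assms(2) sp(1) by (intro measurable_PiM_single') (simp_all add: PiE_def Pi_iff)
  moreover have "(\<lambda>x. snd (f x)) \<in> measurable M (PiM J (\<lambda>_. restrict_space borel {0<..}))"
    using assms(3) sp
    by (intro measurable_PiM_single')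
       (simp_all add: space_restrict_space measurable_restrict_space2_iff PiE_iff Pi_iff)
  ultimately show ?thesis
    unfolding prod_space_def by (simp add: measurable_pair_iff comp_def)
qed

text \<open>Vertices are prescribed at the times in \<open>F\<close> and holding times at those in \<open>G\<close>. The two sets
are kept apart because the last holding time of a path segment involves no transition: cylinders
without it have product weights.\<close>

definition cyl :: "int set \<Rightarrow> int set \<Rightarrow> int set \<Rightarrow> int set \<Rightarrow> (int \<Rightarrow> 'v) \<Rightarrow> (int \<Rightarrow> real set) \<Rightarrow> 'v path set"
  where "cyl I J F G x B =
    {h \<in> space (prod_space I J). (\<forall>i\<in>F. fst h i = x i) \<and> (\<forall>j\<in>G. snd h j \<in> B j)}"

lemma cyl_sets:
  assumes "finite F" "F \<subseteq> I" "finite G" "G \<subseteq> J" "\<And>j. B j \<in> sets borel"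
  shows "cyl I J F G x B \<in> sets (prod_space I J)"
proof -
  have [measurable]: "\<And>j. B j \<in> sets borel" by fact
  have "Measurable.pred (prod_space I J) (\<lambda>h. fst h i = x i)" if "i \<in> F" for i
    using measurable_vertex[of i I J] that assms(2) by auto
  moreover have "Measurable.pred (prod_space I J) (\<lambda>h. snd h j \<in> B j)" if "j \<in> G" for j
    using measurable_time[of j J I] that assms(4) by auto
  ultimately show ?thesis
    unfolding cyl_def using assms(1,3)
    by (intro sets.sets_Collect_conj sets.sets_Collect_finite_All) (auto simp: pred_def)
qed

text \<open>Cylinders over an increasing sequence of finite time sets form a \<open>\<pi>\<close>-system. Since the vertex
set is countable, a coordinate event is a countable union of cylinders, so they generate the
\<open>\<sigma>\<close>-algebra, and countably many cylinders over the first time set cover the space. That covering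
is what makes infinite measures such as the stationary one accessible.\<close>

lemma prod_space_measure_eqI:
  fixes M N :: "'v path measure" and F G :: "nat \<Rightarrow> int set"
  assumes V: "countable (UNIV :: 'v set)"
    and sets: "sets M = sets (prod_space I J)" "sets N = sets (prod_space I J)"
    and F: "\<And>n. finite (F n)" "incseq F" "(\<Union>n. F n) = I"
    and G: "\<And>n. finite (G n)" "incseq G" "(\<Union>n. G n) = J"
    and eq: "\<And>n x B. (\<And>j. B j \<in> sets borel) \<Longrightarrow>
        emeasure M (cyl I J (F n) (G n) x B) = emeasure N (cyl I J (F n) (G n) x B)"
    and fin: "\<And>x. emeasure M (cyl I J (F 0) (G 0) x (\<lambda>_. UNIV)) \<noteq> \<infinity>"
  shows "M = N"
proof -
  define \<Omega> where "\<Omega> = space (prod_space I J :: 'v path measure)"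
  define c where "c n x B = cyl I J (F n) (G n) x B" for n and x :: "int \<Rightarrow> 'v" and B
  define \<G> where "\<G> = insert {} {c n x B | n x B. \<forall>j. B j \<in> sets borel}"
  have FI: "F n \<subseteq> I" and GJ: "G n \<subseteq> J" for n using F(3) G(3) by auto
  have csets: "c n x B \<in> sets (prod_space I J)" if "\<forall>j. B j \<in> sets borel" for n x B
    unfolding c_def using F G FI GJ that by (intro cyl_sets) auto
  have \<G>sub: "\<G> \<subseteq> Pow \<Omega>" by (auto simp: \<G>_def c_def cyl_def \<Omega>_def)
  have cnt: "countable (PiE (F n) (\<lambda>_. UNIV :: 'v set))" for n
    by (intro countable_PiE F V)
  have int: "c n x B \<inter> c m y D \<in> \<G>" if nm: "n \<le> m" and B: "\<forall>j. B j \<in> sets borel" "\<forall>j. D j \<in> sets borel"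
    for n m x B y D
  proof (cases "\<forall>i\<in>F n. x i = y i")
    case True
    define D' where "D' j = (if j \<in> G n then B j \<inter> D j else D j)" for j
    have "F n \<subseteq> F m" "G n \<subseteq> G m" using F(2) G(2) nm by (auto dest: incseqD)
    then have "c n x B \<inter> c m y D = c m y D'"
      unfolding c_def cyl_def D'_def using True by (auto split: if_splits)
    moreover have "\<forall>j. D' j \<in> sets borel" using B by (auto simp: D'_def)
    ultimately show ?thesis unfolding \<G>_def by blast
  next
    case False
    then have "c n x B \<inter> c m y D = {}"
      using incseqD[OF F(2) nm] unfolding c_def cyl_def by force
    then show ?thesis by (simp add: \<G>_def)
  qed
  have Int: "Int_stable \<G>"
  proof (rule Int_stableI)
    fix a b assume "a \<in> \<G>" "b \<in> \<G>"
    show "a \<inter> b \<in> \<G>"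
    proof (cases "a = {} \<or> b = {}")
      case True then show ?thesis by (auto simp: \<G>_def)
    next
      case False
      then obtain n x B m y D where ab: "a = c n x B" "b = c m y D"
        and BD: "\<forall>j. B j \<in> sets borel" "\<forall>j. D j \<in> sets borel"
        using \<open>a \<in> \<G>\<close> \<open>b \<in> \<G>\<close> unfolding \<G>_def by blast
      show ?thesis
        using int[of n m B D x y] int[of m n D B y x] BD ab by (cases "n \<le> m") (auto simp: Int_commute)
    qed
  qed
  let ?S = "sigma \<Omega> \<G>"
  have S: "space ?S = \<Omega>" "sets ?S = sigma_sets \<Omega> \<G>"
    using \<G>sub by (auto simp: space_measure_of sets_measure_of)
  have cS: "c n x B \<in> sets ?S" if "\<forall>j. B j \<in> sets borel" for n x B
    using that \<G>sub by (auto simp: \<G>_def intro!: in_measure_of)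
  \<comment> \<open>each path lies in the cylinder given by its own vertices, and these cylinders are countably many\<close>
  have dec: "{h \<in> \<Omega>. P h} = (\<Union>x\<in>{x\<in>PiE (F n) (\<lambda>_. UNIV). Q x}. c n x B)"
    if "\<And>x h. h \<in> c n x (\<lambda>_. UNIV) \<Longrightarrow> Q x \<and> h \<in> c n x B \<longleftrightarrow> P h"
      "\<And>x h. h \<in> c n x B \<Longrightarrow> h \<in> c n x (\<lambda>_. UNIV)" for P Q n B
  proof -
    have "h \<in> c n (restrict (fst h) (F n)) (\<lambda>_. UNIV)" if "h \<in> \<Omega>" for h
      using that by (auto simp: c_def cyl_def \<Omega>_def)
    note r = this
    have sub: "h \<in> \<Omega>" if "h \<in> c n x B" for h x using that by (auto simp: c_def cyl_def \<Omega>_def)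
    have ext: "restrict (fst h) (F n) \<in> PiE (F n) (\<lambda>_. UNIV)" for h :: "'v path" by auto
    show ?thesis
    proof (intro set_eqI iffI)
      fix h assume "h \<in> {h \<in> \<Omega>. P h}"
      then have "h \<in> \<Omega>" "P h" by auto
      then show "h \<in> (\<Union>x\<in>{x\<in>PiE (F n) (\<lambda>_. UNIV). Q x}. c n x B)"
        using that(1)[OF r[of h]] ext[of h] by blast
    next
      fix h assume "h \<in> (\<Union>x\<in>{x\<in>PiE (F n) (\<lambda>_. UNIV). Q x}. c n x B)"
      then obtain x where x: "Q x" "h \<in> c n x B" by blast
      show "h \<in> {h \<in> \<Omega>. P h}"
        using that(1)[OF that(2)[OF x(2)]] x sub[OF x(2)] by simp
    qed
  qed
  have id: "(\<lambda>h. h) \<in> measurable ?S (prod_space I J)"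
  proof (rule measurable_into_prod_space)
    show "(\<lambda>h. h) \<in> space ?S \<rightarrow> space (prod_space I J)"
      unfolding S(1) by (simp add: \<Omega>_def)
    fix k assume "k \<in> I"
    then obtain n where n: "k \<in> F n" using F(3) by auto
    have "{h \<in> \<Omega>. fst h k = a} \<in> sets ?S" for a
    proof -
      have "{h \<in> \<Omega>. fst h k = a} = (\<Union>x\<in>{x\<in>PiE (F n) (\<lambda>_. UNIV). x k = a}. c n x (\<lambda>_. UNIV))"
        by (rule dec) (use n in \<open>auto simp: c_def cyl_def\<close>)
      also have "\<dots> \<in> sets ?S"
        by (rule sets.countable_UN''[OF countable_subset[OF _ cnt[of n]]]) (auto intro!: cS)
      finally show ?thesis .
    qed
    then show "(\<lambda>h. fst h k) \<in> measurable ?S (count_space UNIV)"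
      unfolding measurable_count_space_eq_countable[OF V]
      by (simp add: S(1) vimage_def Int_def conj_commute)
  next
    fix k assume "k \<in> J"
    then obtain n where n: "k \<in> G n" using G(3) by auto
    have "{h \<in> \<Omega>. snd h k \<in> A} \<in> sets ?S" if A: "A \<in> sets borel" for A
    proof -
      have "{h \<in> \<Omega>. snd h k \<in> A} = (\<Union>x\<in>{x\<in>PiE (F n) (\<lambda>_. UNIV). True}. c n x ((\<lambda>_. UNIV)(k := A)))"
        by (rule dec) (use n in \<open>auto simp: c_def cyl_def\<close>)
      also have "\<dots> \<in> sets ?S"
        using A by (intro sets.countable_UN''[OF countable_subset[OF _ cnt[of n]]]) (auto intro!: cS)
      finally show ?thesis .
    qed
    then show "(\<lambda>h. snd h k) \<in> borel_measurable ?S"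
      by (intro measurableI) (simp_all add: S(1) vimage_def Int_def conj_commute)
  qed
  have gen: "sets (prod_space I J) = sigma_sets \<Omega> \<G>"
  proof
    show "sigma_sets \<Omega> \<G> \<subseteq> sets (prod_space I J)"
      unfolding \<Omega>_def using csets by (intro sets.sigma_sets_subset) (auto simp: \<G>_def)
    show "sets (prod_space I J) \<subseteq> sigma_sets \<Omega> \<G>"
    proof
      fix A :: "'v path set" assume A: "A \<in> sets (prod_space I J)"
      have "A \<inter> \<Omega> = A" using sets.sets_into_space[OF A] by (intro Int_absorb2) (simp add: \<Omega>_def)
      then show "A \<in> sigma_sets \<Omega> \<G>"
        using measurable_sets[OF id A] unfolding S vimage_ident by (rule subst)
    qed
  qed
  show ?thesis
  proof (rule measure_eqI_generator_eq_countable[where E = \<G> and \<Omega> = \<Omega>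
        and A = "(\<lambda>x. c 0 x (\<lambda>_. UNIV)) ` PiE (F 0) (\<lambda>_. UNIV)"])
    show "Int_stable \<G>" "\<G> \<subseteq> Pow \<Omega>" by fact+
    show "emeasure M X = emeasure N X" if "X \<in> \<G>" for X
      using that eq unfolding \<G>_def c_def by auto
    show "sets M = sigma_sets \<Omega> \<G>" "sets N = sigma_sets \<Omega> \<G>" using sets gen by auto
    show "(\<lambda>x. c 0 x (\<lambda>_. UNIV)) ` PiE (F 0) (\<lambda>_. UNIV) \<subseteq> \<G>"
    proof
      fix a assume "a \<in> (\<lambda>x. c 0 x (\<lambda>_. UNIV)) ` PiE (F 0) (\<lambda>_. UNIV)"
      then obtain x where "a = c 0 x (\<lambda>_. UNIV)" by blast
      moreover have "\<forall>j::int. (UNIV :: real set) \<in> sets borel" by simp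
      ultimately show "a \<in> \<G>" unfolding \<G>_def by blast
    qed
    show "countable ((\<lambda>x. c 0 x (\<lambda>_. UNIV)) ` PiE (F 0) (\<lambda>_. UNIV))"
      by (rule countable_image[OF cnt])
    have "{h \<in> \<Omega>. True} = (\<Union>x\<in>{x\<in>PiE (F 0) (\<lambda>_. UNIV). True}. c 0 x (\<lambda>_. UNIV))"
      by (rule dec[where P = "\<lambda>_. True" and Q = "\<lambda>_. True"]) simp_all
    then show "\<Union> ((\<lambda>x. c 0 x (\<lambda>_. UNIV)) ` PiE (F 0) (\<lambda>_. UNIV)) = \<Omega>" by simp
    show "emeasure M a \<noteq> \<infinity>" if "a \<in> (\<lambda>x. c 0 x (\<lambda>_. UNIV)) ` PiE (F 0) (\<lambda>_. UNIV)" for a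
      using that fin by (auto simp: c_def)
  qed
qed

section \<open>The jump chain and its construction\<close>

locale jump_process =
  fixes E :: "'v set set" and C :: "'v \<Rightarrow> 'v \<Rightarrow> real" and \<beta> u :: "'v \<Rightarrow> real"
  assumes graph: "conductance_graph E C"
    and \<beta>_pos: "\<beta> x > 0"
    and \<beta>_eq: "\<beta> x = 1 / 2 * (\<Sum>\<^sub>\<infinity>y\<in>UNIV. C x y * exp (u y - u x))"
begin

definition p :: "'v \<Rightarrow> 'v \<Rightarrow> real" where
  "p x y = C x y * exp (u y) / (\<Sum>\<^sub>\<infinity>v\<in>UNIV. C x v * exp (u v))"

text \<open>Everything reachable from a fixed vertex forms a countable set because each vertex has finitely
many neighbours; connectedness makes this all vertices.\<close>

lemma countable_vertices: "countable (UNIV :: 'v set)"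
proof -
  let ?R = "{(a, b). {a, b} \<in> E}" and ?x = "undefined :: 'v"
  have fin: "finite (?R `` {x})" for x
    using graph by (auto simp: conductance_graph_def Image_def)
  have "countable (?R\<^sup>* `` {?x})"
  proof (rule countable_rtrancl)
    fix Y :: "'v set" assume "countable Y"
    moreover have "?R `` Y = (\<Union>y\<in>Y. ?R `` {y})" by auto
    ultimately show "countable (?R `` Y)" using fin by (simp only: countable_UN countable_finite)
  qed simp
  moreover have "?R\<^sup>* `` {?x} = UNIV" using graph by (auto simp: conductance_graph_def)
  ultimately show ?thesis by simp
qed

lemma conductance_nonneg: "0 \<le> C x y"
  using graph unfolding conductance_graph_def by (metis less_eq_real_def)

lemma sum_weights: "(\<Sum>\<^sub>\<infinity>v\<in>UNIV. C x v * exp (u v)) = 2 * \<beta> x * exp (u x)"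
proof -
  have "(\<lambda>y. C x y * exp (u y - u x)) = (\<lambda>y. C x y * exp (u y) * exp (- u x))"
    by (simp add: exp_diff exp_minus field_simps)
  then have "\<beta> x = 1 / 2 * ((\<Sum>\<^sub>\<infinity>v\<in>UNIV. C x v * exp (u v)) * exp (- u x))"
    using \<beta>_eq[of x] by (simp only: infsum_cmult_left')
  then show ?thesis by (simp add: exp_minus field_simps)
qed

lemma p_eq: "p x y = C x y * exp (u y) / (2 * \<beta> x * exp (u x))"
  by (simp add: p_def sum_weights)

lemma p_nonneg: "0 \<le> p x y"
  using \<beta>_pos[of x] conductance_nonneg[of x y] by (simp add: p_eq)

lemma p_edge: "{x, y} \<in> E \<Longrightarrow> 0 < p x y"
  using \<beta>_pos[of x] graph by (simp add: p_eq conductance_graph_def)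

lemma p_nonedge: "{x, y} \<notin> E \<Longrightarrow> p x y = 0"
  using graph by (simp add: p_eq conductance_graph_def)

lemma p_sum: "(\<integral>\<^sup>+y. ennreal (p x y) \<partial>count_space UNIV) = 1"
proof -
  let ?N = "{y. {x, y} \<in> E}"
  have fin: "finite ?N" using graph by (simp add: conductance_graph_def)
  have "(\<Sum>\<^sub>\<infinity>v\<in>UNIV. C x v * exp (u v)) = (\<Sum>\<^sub>\<infinity>v\<in>?N. C x v * exp (u v))"
  proof (rule infsum_cong_neutral)
    fix v assume "v \<in> UNIV - ?N"
    then have "C x v = 0" using graph unfolding conductance_graph_def by blast
    then show "C x v * exp (u v) = 0" by simp
  qed auto
  then have s: "(\<Sum>v\<in>?N. C x v * exp (u v)) = 2 * \<beta> x * exp (u x)"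
    using fin by (simp add: sum_weights)
  have "(\<integral>\<^sup>+y. ennreal (p x y) \<partial>count_space UNIV) = (\<Sum>y\<in>?N. ennreal (p x y))"
    using fin p_nonedge by (intro nn_integral_count_space') auto
  also have "\<dots> = ennreal (\<Sum>y\<in>?N. p x y)" by (simp add: p_nonneg sum_ennreal)
  also have "(\<Sum>y\<in>?N. p x y) = 1"
    using \<beta>_pos[of x] by (simp add: p_eq sum_divide_distrib[symmetric] s)
  finally show ?thesis by simp
qed

text \<open>The reversible measure of the jump chain \<open>p\<close>. It differs from the reversible measure
\<open>exp (2 * u x)\<close> of the continuous-time process by the total jump rate \<open>\<beta> x\<close>.\<close>

definition c :: "'v \<Rightarrow> real" where "c x = \<beta> x * exp (2 * u x)"

lemma c_pos: "0 < c x" using \<beta>_pos[of x] by (simp add: c_def)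

lemma detailed_balance: "c x * p x y = c y * p y x"
proof -
  have "C x y = C y x" using graph by (simp add: conductance_graph_def)
  moreover have "exp (2 * u z) = exp (u z) * exp (u z)" for z by (simp add: exp_add[symmetric])
  ultimately show ?thesis
    using \<beta>_pos[of x] \<beta>_pos[of y] by (simp add: c_def p_eq field_simps)
qed

definition step :: "'v \<Rightarrow> 'v pmf" where "step x = embed_pmf (p x)"

lemma pmf_step: "pmf (step x) y = p x y"
  unfolding step_def by (rule pmf_embed_pmf) (simp_all add: p_nonneg p_sum)

abbreviation expo :: "'v \<Rightarrow> real measure" where
  "expo x \<equiv> density lborel (\<lambda>t. ennreal (exponential_density (\<beta> x) t))"

text \<open>The exponential law carried by the open half-line, on which the holding times of \<open>prod_space\<close>
live.\<close>

definition hold :: "'v \<Rightarrow> real measure" where "hold x = restrict_space (expo x) {0<..}"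

lemma prob_space_expo: "prob_space (expo x)"
  by (rule prob_space_exponential_density[OF \<beta>_pos])

lemma AE_expo_pos: "AE t in expo x. 0 < t"
  using AE_lborel_singleton[of 0]
  by (subst AE_density) (auto simp: exponential_density_def elim!: eventually_mono)

lemma emeasure_hold:
  assumes "B \<in> sets borel"
  shows "emeasure (hold x) (B \<inter> {0<..}) = emeasure (expo x) B"
proof -
  have "emeasure (hold x) (B \<inter> {0<..}) = emeasure (expo x) (B \<inter> {0<..})"
    unfolding hold_def by (rule emeasure_restrict_space) auto
  also have "\<dots> = emeasure (expo x) B"
    using assms AE_expo_pos[of x] by (intro emeasure_eq_AE) (auto elim!: eventually_mono)
  finally show ?thesis .
qed

lemma space_hold: "space (hold x) = {0<..}"
  and sets_hold: "sets (hold x) = sets (restrict_space borel {0<..})"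
  by (auto simp: hold_def space_restrict_space sets_restrict_space)

lemma prob_space_hold: "prob_space (hold x)"
  using emeasure_hold[of UNIV x] prob_space.emeasure_space_1[OF prob_space_expo[of x]]
  by (intro prob_spaceI) (simp add: space_hold)

lemma expo_at_least:
  assumes "0 \<le> a" shows "measure (expo x) {a..} = exp (- a * \<beta> x)"
proof -
  interpret prob_space "expo x" by (rule prob_space_expo)
  have "distributed (expo x) lborel (\<lambda>t. t) (exponential_density (\<beta> x))"
    unfolding distributed_def by (simp add: distr_id2)
  then have "measure (expo x) {t \<in> space (expo x). a < t} = exp (- a * \<beta> x)"
    by (rule exponential_distributedD_gt) (use assms \<beta>_pos in auto)
  moreover have "AE t in expo x. t \<noteq> a"
    using AE_lborel_singleton[of a] by (subst AE_density) (auto elim!: eventually_mono)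
  then have "measure (expo x) {a..} = measure (expo x) {t \<in> space (expo x). a < t}"
    by (intro finite_measure_eq_AE) (auto elim!: eventually_mono)
  ultimately show ?thesis by simp
qed

text \<open>The probability of a cylinder of \<open>n\<close> jumps, given its initial vertex.\<close>

definition weight :: "nat \<Rightarrow> (nat \<Rightarrow> 'v) \<Rightarrow> (nat \<Rightarrow> real set) \<Rightarrow> real" where
  "weight n x B = (\<Prod>i<n. p (x i) (x (Suc i)) * measure (expo (x i)) (B i))"

lemma weight_nonneg: "0 \<le> weight n x B"
  unfolding weight_def by (intro prod_nonneg mult_nonneg_nonneg) (auto simp: p_nonneg)

text \<open>Each pair \<open>(k, x)\<close> carries an independent instruction for a walker that is at \<open>x\<close> at step \<open>k\<close>:
where to jump next and how long to wait before. As a walk reads at most one instruction per step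
number, cylinder events become product events with finitely many factors.\<close>

definition stacks :: "(nat \<times> 'v \<Rightarrow> 'v \<times> real) measure" where
  "stacks = PiM UNIV (\<lambda>i. measure_pmf (step (snd i)) \<Otimes>\<^sub>M hold (snd i))"

primrec chain :: "'v \<Rightarrow> (nat \<times> 'v \<Rightarrow> 'v \<times> real) \<Rightarrow> nat \<Rightarrow> 'v" where
  "chain z \<omega> 0 = z"
| "chain z \<omega> (Suc k) = fst (\<omega> (k, chain z \<omega> k))"

definition walk :: "'v \<Rightarrow> (nat \<times> 'v \<Rightarrow> 'v \<times> real) \<Rightarrow> 'v path" where
  "walk z \<omega> = (\<lambda>k\<in>{0..}. chain z \<omega> (nat k),
                \<lambda>k\<in>{0..}. snd (\<omega> (nat k, chain z \<omega> (nat k))))"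

definition law :: "'v \<Rightarrow> 'v path measure" where
  "law z = distr stacks (prod_space {0..} {0..}) (walk z)"

lemma product_prob_space_stacks:
  "product_prob_space (\<lambda>i :: nat \<times> 'v. measure_pmf (step (snd i)) \<Otimes>\<^sub>M hold (snd i))"
proof -
  have "prob_space (measure_pmf (step x) \<Otimes>\<^sub>M hold x)" for x
    by (intro prob_space_pair measure_pmf.prob_space_axioms prob_space_hold)
  then show ?thesis
    by (intro product_prob_spaceI)
qed

lemma prob_space_stacks: "prob_space stacks"
proof -
  interpret product_prob_space "\<lambda>i :: nat \<times> 'v. measure_pmf (step (snd i)) \<Otimes>\<^sub>M hold (snd i)" UNIV
    by (rule product_prob_space_stacks)
  show ?thesis unfolding stacks_def by (rule P.prob_space_axioms)
qed

lemma measurable_stack_coordinates: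
  "(\<lambda>\<omega>. fst (\<omega> i)) \<in> measurable stacks (count_space UNIV)"
  "(\<lambda>\<omega>. snd (\<omega> i)) \<in> borel_measurable stacks"
proof -
  have *: "(\<lambda>\<omega>. \<omega> i) \<in> measurable stacks (measure_pmf (step (snd i)) \<Otimes>\<^sub>M hold (snd i))"
    unfolding stacks_def by (rule measurable_component_singleton) simp
  have "(\<lambda>\<omega>. fst (\<omega> i)) \<in> measurable stacks (measure_pmf (step (snd i)))"
    by (rule measurable_compose[OF * measurable_fst])
  then show "(\<lambda>\<omega>. fst (\<omega> i)) \<in> measurable stacks (count_space UNIV)"
    by simp
  have "(\<lambda>\<omega>. snd (\<omega> i)) \<in> measurable stacks (hold (snd i))"
    by (rule measurable_compose[OF * measurable_snd])
  then have "(\<lambda>\<omega>. snd (\<omega> i)) \<in> measurable stacks (restrict_space borel {0<..})"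
    by (simp add: measurable_cong_sets[OF refl sets_hold])
  then show "(\<lambda>\<omega>. snd (\<omega> i)) \<in> borel_measurable stacks"
    unfolding measurable_restrict_space2_iff by blast
qed

lemma stack_time_pos:
  "\<omega> \<in> space stacks \<Longrightarrow> 0 < snd (\<omega> i)"
  unfolding stacks_def space_PiM
  by (simp add: space_pair_measure space_hold PiE_def Pi_iff mem_Times_iff split_paired_All) (cases i, simp)

lemma measurable_chain: "(\<lambda>\<omega>. chain z \<omega> k) \<in> measurable stacks (count_space UNIV)"
proof (induction k)
  case (Suc k)
  show ?case unfolding chain.simps
    by (rule measurable_compose_countable'[OF measurable_stack_coordinates(1) Suc countable_vertices])
qed simp

lemma measurable_walk: "walk z \<in> measurable stacks (prod_space {0..} {0..})"
proof (rule measurable_into_prod_space)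
  show "walk z \<in> space stacks \<rightarrow> space (prod_space {0..} {0..})"
    by (auto simp: walk_def space_prod_space stack_time_pos)
  fix k :: int assume k: "k \<in> {0..}"
  then show "(\<lambda>\<omega>. fst (walk z \<omega>) k) \<in> measurable stacks (count_space UNIV)"
    by (simp add: walk_def measurable_chain)
  have "(\<lambda>\<omega>. snd (\<omega> (nat k, chain z \<omega> (nat k)))) \<in> borel_measurable stacks"
    by (rule measurable_compose_countable'[OF measurable_stack_coordinates(2) measurable_chain countable_vertices])
  then show "(\<lambda>\<omega>. snd (walk z \<omega>) k) \<in> borel_measurable stacks"
    using k by (simp add: walk_def)
qed

lemma sets_law: "sets (law z) = sets (prod_space {0..} {0..})"
  by (simp add: law_def)

lemma space_law: "space (law z) = space (prod_space {0..} {0..})"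
  by (simp add: law_def)

lemma prob_space_law: "prob_space (law z)"
  unfolding law_def by (rule prob_space.prob_space_distr[OF prob_space_stacks measurable_walk])

definition ocyl :: "nat \<Rightarrow> (int \<Rightarrow> 'v) \<Rightarrow> (int \<Rightarrow> real set) \<Rightarrow> 'v path set" where
  "ocyl n = cyl {0..} {0..} {0..int n} {0..<int n}"

lemma ocyl_alt:
  "ocyl n x B = {h \<in> space (prod_space {0..} {0..}).
     (\<forall>i\<le>n. fst h (int i) = x (int i)) \<and> (\<forall>i<n. snd h (int i) \<in> B (int i))}"
proof -
  have "(\<forall>i\<in>{0..int n}. P i) \<longleftrightarrow> (\<forall>i\<le>n. P (int i))" for P
    by (auto) (metis nonneg_int_cases of_nat_le_iff)
  moreover have "(\<forall>i\<in>{0..<int n}. P i) \<longleftrightarrow> (\<forall>i<n. P (int i))" for P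
    by (auto) (metis nonneg_int_cases of_nat_less_iff)
  ultimately show ?thesis unfolding ocyl_def cyl_def by simp
qed

lemma ocyl_sets: "(\<And>j. B j \<in> sets borel) \<Longrightarrow> ocyl n x B \<in> sets (prod_space {0..} {0..})"
  unfolding ocyl_def by (intro cyl_sets) auto

text \<open>On the event that the walk follows \<open>x\<close>, it reads exactly the instructions \<open>(i, x i)\<close>, so the
cylinder is a product event over these distinct indices.\<close>

lemma emeasure_law_ocyl:
  assumes B: "\<And>j. B j \<in> sets borel"
  shows "emeasure (law z) (ocyl n x B) =
    (if x 0 = z then ennreal (weight n (\<lambda>i. x (int i)) (\<lambda>i. B (int i))) else 0)"
proof (cases "x 0 = z")
  case True
  interpret product_prob_space "\<lambda>i :: nat \<times> 'v. measure_pmf (step (snd i)) \<Otimes>\<^sub>M hold (snd i)" UNIV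
    by (rule product_prob_space_stacks)
  define y where "y i = x (int i)" for i
  define D where "D i = B (int i)" for i
  define J where "J = (\<lambda>i. (i, y i)) ` {..<n}"
  define X where "X j = {y (Suc (fst j))} \<times> (D (fst j) \<inter> {0<..})" for j :: "nat \<times> 'v"
  have ch: "(\<forall>i\<le>n. chain z \<omega> i = y i) \<longleftrightarrow> (\<forall>i<n. fst (\<omega> (i, y i)) = y (Suc i))" for \<omega>
  proof
    assume r: "\<forall>i<n. fst (\<omega> (i, y i)) = y (Suc i)"
    have "i \<le> n \<Longrightarrow> chain z \<omega> i = y i" for i
      by (induction i) (use True r in \<open>auto simp: y_def\<close>)
    then show "\<forall>i\<le>n. chain z \<omega> i = y i" by blast
  next
    assume l: "\<forall>i\<le>n. chain z \<omega> i = y i"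
    show "\<forall>i<n. fst (\<omega> (i, y i)) = y (Suc i)"
    proof (intro allI impI)
      fix i assume "i < n"
      then show "fst (\<omega> (i, y i)) = y (Suc i)" using l[rule_format, of "Suc i"] l[rule_format, of i] by simp
    qed
  qed
  have mem: "walk z \<omega> \<in> ocyl n x B \<longleftrightarrow> (\<forall>j\<in>J. \<omega> j \<in> X j)" if \<omega>: "\<omega> \<in> space stacks" for \<omega>
  proof -
    have "walk z \<omega> \<in> space (prod_space {0..} {0..})" using measurable_space[OF measurable_walk \<omega>] .
    then have "walk z \<omega> \<in> ocyl n x B \<longleftrightarrow>
        (\<forall>i\<le>n. chain z \<omega> i = y i) \<and> (\<forall>i<n. snd (\<omega> (i, chain z \<omega> i)) \<in> D i)"
      by (simp add: ocyl_alt walk_def y_def D_def)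
    also have "\<dots> \<longleftrightarrow> (\<forall>i\<le>n. chain z \<omega> i = y i) \<and> (\<forall>i<n. snd (\<omega> (i, y i)) \<in> D i)"
      by auto
    also have "\<dots> \<longleftrightarrow> (\<forall>j\<in>J. \<omega> j \<in> X j)"
      unfolding ch using stack_time_pos[OF \<omega>] by (auto simp: J_def X_def mem_Times_iff)
    finally show ?thesis .
  qed
  have X: "X j \<in> sets (measure_pmf (step (snd j)) \<Otimes>\<^sub>M hold (snd j))" for j
    unfolding X_def D_def using B by (intro pair_measureI) (auto simp: sets_hold sets_restrict_space)
  have "emeasure (law z) (ocyl n x B) = emeasure stacks (walk z -` ocyl n x B \<inter> space stacks)"
    unfolding law_def by (rule emeasure_distr[OF measurable_walk ocyl_sets[OF B]])
  also have "walk z -` ocyl n x B \<inter> space stacks = {\<omega> \<in> space stacks. \<forall>j\<in>J. \<omega> j \<in> X j}"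
    using mem by blast
  also have "emeasure stacks \<dots> = (\<Prod>j\<in>J. emeasure (measure_pmf (step (snd j)) \<Otimes>\<^sub>M hold (snd j)) (X j))"
    unfolding stacks_def by (rule emeasure_PiM_Collect) (use X in \<open>auto simp: J_def\<close>)
  also have "\<dots> = (\<Prod>i<n. emeasure (measure_pmf (step (y i)) \<Otimes>\<^sub>M hold (y i)) (X (i, y i)))"
    unfolding J_def by (subst prod.reindex) (auto simp: inj_on_def)
  also have "\<dots> = (\<Prod>i<n. ennreal (p (y i) (y (Suc i)) * measure (expo (y i)) (D i)))"
  proof (intro prod.cong refl)
    fix i
    interpret h: prob_space "hold (y i)" by (rule prob_space_hold)
    interpret e: prob_space "expo (y i)" by (rule prob_space_expo)
    have "emeasure (measure_pmf (step (y i)) \<Otimes>\<^sub>M hold (y i)) (X (i, y i)) =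
        emeasure (measure_pmf (step (y i))) {y (Suc i)} * emeasure (hold (y i)) (D i \<inter> {0<..})"
      unfolding X_def fst_conv using B
      by (intro h.emeasure_pair_measure_Times) (auto simp: D_def sets_hold sets_restrict_space)
    also have "\<dots> = ennreal (p (y i) (y (Suc i)) * measure (expo (y i)) (D i))"
      using B by (simp add: emeasure_pmf_single pmf_step emeasure_hold D_def e.emeasure_eq_measure
          ennreal_mult p_nonneg)
    finally show "emeasure (measure_pmf (step (y i)) \<Otimes>\<^sub>M hold (y i)) (X (i, y i)) =
        ennreal (p (y i) (y (Suc i)) * measure (expo (y i)) (D i))" .
  qed
  also have "\<dots> = ennreal (weight n y D)"
    unfolding weight_def by (rule prod_ennreal) (simp add: p_nonneg)
  finally show ?thesis using True unfolding y_def D_def by simp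
next
  case False
  have "walk z -` ocyl n x B \<inter> space stacks = {}"
    using False by (auto simp: ocyl_alt walk_def)
  then show ?thesis
    using False unfolding law_def by (simp add: emeasure_distr[OF measurable_walk ocyl_sets[OF B]])
qed

lemma law_unique:
  assumes "prob_space Q" "sets Q = sets (prod_space {0..} {0..})"
    and "\<And>n x B. (\<And>j. B j \<in> sets borel) \<Longrightarrow> emeasure Q (ocyl n x B) =
      (if x 0 = z then ennreal (weight n (\<lambda>i. x (int i)) (\<lambda>i. B (int i))) else 0)"
  shows "Q = law z"
proof (rule prod_space_measure_eqI[where F = "\<lambda>n. {0..int n}" and G = "\<lambda>n. {0..<int n}"])
  show "sets Q = sets (prod_space {0..} {0..})" "sets (law z) = sets (prod_space {0..} {0..})"
    using assms sets_law by auto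
  have "k \<in> {0..int (nat k)} \<and> k \<in> {0..<int (Suc (nat k))}" if "0 \<le> k" for k
    using that by simp
  then show "(\<Union>n. {0..int n}) = {0..}" "(\<Union>n. {0..<int n}) = {0..}"
    by (fastforce, fastforce)
  interpret prob_space Q by fact
  show "emeasure Q (cyl {0..} {0..} {0..int 0} {0..<int 0} x (\<lambda>_. UNIV)) \<noteq> \<infinity>" for x by simp
  show "emeasure Q (cyl {0..} {0..} {0..int n} {0..<int n} x B) =
      emeasure (law z) (cyl {0..} {0..} {0..int n} {0..<int n} x B)" if "\<And>j. B j \<in> sets borel" for n x B
    unfolding ocyl_def[symmetric] using assms(3) emeasure_law_ocyl that by simp
qed (auto simp: countable_vertices incseq_def)

section \<open>Uniqueness of the jump law\<close>

lemma measurable_restrict_path: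
  assumes "I' \<subseteq> I" "J' \<subseteq> J"
  shows "restrict_path I' J' \<in> measurable (prod_space I J) (prod_space I' J')"
proof (rule measurable_into_prod_space)
  show "restrict_path I' J' \<in> space (prod_space I J) \<rightarrow> space (prod_space I' J')"
    using assms by (auto simp: space_prod_space restrict_path_def)
  show "(\<lambda>h. fst (restrict_path I' J' h) k) \<in> measurable (prod_space I J) (count_space UNIV)"
    if "k \<in> I'" for k
    using measurable_vertex[of k I J] that assms by (auto simp: restrict_path_def split_beta)
  show "(\<lambda>h. snd (restrict_path I' J' h) k) \<in> borel_measurable (prod_space I J)" if "k \<in> J'" for k
    using measurable_time[of k J I] that assms by (auto simp: restrict_path_def split_beta)
qed

abbreviation hist :: "nat \<Rightarrow> 'v path \<Rightarrow> 'v path" where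
  "hist n \<equiv> restrict_path {0..int n} {0..<int n}"

lemma measurable_hist: "hist n \<in> measurable (prod_space {0..} {0..}) (prod_space {0..int n} {0..<int n})"
  by (rule measurable_restrict_path) (simp, rule subsetI, simp)

abbreviation hcyl :: "nat \<Rightarrow> (int \<Rightarrow> 'v) \<Rightarrow> (int \<Rightarrow> real set) \<Rightarrow> 'v path set" where
  "hcyl n \<equiv> cyl {0..int n} {0..<int n} {0..int n} {0..<int n}"

lemma hist_hcyl:
  assumes "h \<in> space (prod_space {0..} {0..})"
  shows "hist n h \<in> hcyl n x B \<longleftrightarrow> h \<in> ocyl n x B"
  using assms measurable_space[OF measurable_hist assms, of n]
  by (auto simp: ocyl_def cyl_def restrict_path_def split_beta)

lemma ocyl_space: "ocyl n x B \<subseteq> space (prod_space {0..} {0..})"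
  by (auto simp: ocyl_alt)

lemma ocyl_Suc:
  "ocyl (Suc n) x B = {h \<in> ocyl n x B. fst h (int n + 1) = x (int n + 1) \<and> snd h (int n) \<in> B (int n)}"
  unfolding ocyl_alt by (auto simp: le_Suc_eq less_Suc_eq add.commute)

lemma weight_Suc:
  "weight (Suc n) x B = weight n x B * (p (x n) (x (Suc n)) * measure (expo (x n)) (B n))"
  by (simp add: weight_def)

lemma weight_cong:
  "(\<And>i. i \<le> n \<Longrightarrow> x i = x' i) \<Longrightarrow> (\<And>i. i < n \<Longrightarrow> B i = B' i) \<Longrightarrow> weight n x B = weight n x' B'"
  by (auto simp: weight_def intro!: prod.cong)

text \<open>For a fixed transition and set of holding times, both sides of the conditional law are finite measures in
the event \<open>H\<close> of the past. They agree on cylinders, hence everywhere.\<close>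

lemma is_jump_law_law: "is_jump_law C u \<beta> z (law z)"
proof -
  interpret Q: prob_space "law z" by (rule prob_space_law)
  let ?\<Omega> = "space (prod_space {0..} {0..}) :: 'v path set"
  have start: "AE (w, l) in law z. w 0 = z"
  proof -
    have "AE \<omega> in stacks. fst (walk z \<omega>) 0 = z" by (simp add: walk_def)
    then have "AE h in law z. fst h 0 = z"
      unfolding law_def using measurable_vertex[of 0 "{0..}" "{0..}"]
      by (subst AE_distr_iff[OF measurable_walk]) (auto simp: pred_def)
    then show ?thesis by (simp add: split_beta)
  qed
  have step: "measure (law z) {h \<in> ?\<Omega>. hist n h \<in> H \<and> fst h (int n) = x \<and>
        fst h (int n + 1) = y \<and> snd h (int n) \<in> B} =
      measure (law z) {h \<in> ?\<Omega>. hist n h \<in> H \<and> fst h (int n) = x} * (p x y * measure (expo x) B)"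
    if H: "H \<in> sets (prod_space {0..int n} {0..<int n})" and B: "B \<in> sets borel" for n H x y B
  proof -
    let ?P = "prod_space {0..int n} {0..<int n} :: 'v path measure"
    define S1 where "S1 = {h \<in> ?\<Omega>. fst h (int n) = x \<and> fst h (int n + 1) = y \<and> snd h (int n) \<in> B}"
    define S2 where "S2 = {h \<in> ?\<Omega>. fst h (int n) = x}"
    define k where "k = p x y * measure (expo x) B"
    have k: "0 \<le> k" by (simp add: k_def p_nonneg)
    have S: "S1 \<in> sets (law z)" "S2 \<in> sets (law z)"
    proof -
      note [measurable] = B
      have [measurable]: "(\<lambda>h. fst h (int n)) \<in> measurable (prod_space {0..} {0..}) (count_space UNIV)"
        "(\<lambda>h. fst h (int n + 1)) \<in> measurable (prod_space {0..} {0..}) (count_space UNIV)"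
        "(\<lambda>h. snd h (int n)) \<in> borel_measurable (prod_space {0..} {0..})"
        by (auto intro!: measurable_vertex measurable_time)
      show "S1 \<in> sets (law z)" "S2 \<in> sets (law z)"
        unfolding S1_def S2_def sets_law by measurable
    qed
    have hist: "hist n \<in> measurable (law z) ?P"
      using measurable_hist by (simp add: measurable_cong_sets[OF sets_law refl])
    define M1 where "M1 = distr (density (law z) (indicator S1)) ?P (hist n)"
    define M2 where "M2 = scale_measure (ennreal k) (distr (density (law z) (indicator S2)) ?P (hist n))"
    have M1: "emeasure M1 X = emeasure (law z) (S1 \<inter> {h \<in> ?\<Omega>. hist n h \<in> X})"
      and M2: "emeasure M2 X = ennreal k * emeasure (law z) (S2 \<inter> {h \<in> ?\<Omega>. hist n h \<in> X})"
      if X: "X \<in> sets ?P" for X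
    proof -
      have "{h \<in> ?\<Omega>. hist n h \<in> X} = hist n -` X \<inter> space (law z)" by (auto simp: space_law)
      then show "emeasure M1 X = emeasure (law z) (S1 \<inter> {h \<in> ?\<Omega>. hist n h \<in> X})"
        "emeasure M2 X = ennreal k * emeasure (law z) (S2 \<inter> {h \<in> ?\<Omega>. hist n h \<in> X})"
        using hist X S measurable_sets[OF hist X]
        by (simp_all add: M1_def M2_def emeasure_distr emeasure_restricted)
    qed
    have "M1 = M2"
    proof (rule prod_space_measure_eqI[where F = "\<lambda>_. {0..int n}" and G = "\<lambda>_. {0..<int n}"])
      have X: "hcyl n x' (\<lambda>_. UNIV) \<in> sets ?P" for x' by (intro cyl_sets) auto
      show "emeasure M1 (hcyl n x' (\<lambda>_. UNIV)) \<noteq> \<infinity>" for x'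
        by (simp add: M1[OF X] Q.emeasure_eq_measure)
      fix x' :: "int \<Rightarrow> 'v" and B' :: "int \<Rightarrow> real set"
      assume B': "\<And>j. B' j \<in> sets borel"
      have X: "hcyl n x' B' \<in> sets ?P" by (intro cyl_sets B') auto
      have eq: "{h \<in> ?\<Omega>. hist n h \<in> hcyl n x' B'} = ocyl n x' B'"
        using hist_hcyl ocyl_space by blast
      show "emeasure M1 (hcyl n x' B') = emeasure M2 (hcyl n x' B')"
      proof (cases "x' (int n) = x")
        case True
        let ?x = "x'(int n + 1 := y)" and ?B = "B'(int n := B)"
        have "S1 \<inter> ocyl n x' B' = ocyl (Suc n) ?x ?B"
          unfolding ocyl_Suc using True by (auto simp: S1_def ocyl_def cyl_def)
        moreover have "S2 \<inter> ocyl n x' B' = ocyl n x' B'"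
          using True by (auto simp: S2_def ocyl_def cyl_def)
        moreover have "weight (Suc n) (\<lambda>i. ?x (int i)) (\<lambda>i. ?B (int i)) =
            weight n (\<lambda>i. x' (int i)) (\<lambda>i. B' (int i)) * k"
        proof -
          have "weight n (\<lambda>i. ?x (int i)) (\<lambda>i. ?B (int i)) = weight n (\<lambda>i. x' (int i)) (\<lambda>i. B' (int i))"
            by (rule weight_cong) auto
          then show ?thesis using True by (simp add: weight_Suc k_def add.commute)
        qed
        ultimately show ?thesis
          using B B' k by (simp add: M1[OF X] M2[OF X] eq emeasure_law_ocyl weight_nonneg
              ennreal_mult' mult.commute)
      next
        case False
        then have "S1 \<inter> ocyl n x' B' = {}" "S2 \<inter> ocyl n x' B' = {}"
          by (auto simp: S1_def S2_def ocyl_def cyl_def)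
        then show ?thesis by (simp add: M1[OF X] M2[OF X] eq)
      qed
    qed (auto simp: M1_def M2_def countable_vertices incseq_def)
    then have "emeasure (law z) (S1 \<inter> {h \<in> ?\<Omega>. hist n h \<in> H}) =
        ennreal k * emeasure (law z) (S2 \<inter> {h \<in> ?\<Omega>. hist n h \<in> H})"
      using M1[OF H] M2[OF H] by simp
    then have "measure (law z) (S1 \<inter> {h \<in> ?\<Omega>. hist n h \<in> H}) =
        k * measure (law z) (S2 \<inter> {h \<in> ?\<Omega>. hist n h \<in> H})"
      using k by (simp add: Q.emeasure_eq_measure ennreal_mult'[symmetric])
    moreover have "S1 \<inter> {h \<in> ?\<Omega>. hist n h \<in> H} = {h \<in> ?\<Omega>. hist n h \<in> H \<and> fst h (int n) = x \<and>
        fst h (int n + 1) = y \<and> snd h (int n) \<in> B}"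
      "S2 \<inter> {h \<in> ?\<Omega>. hist n h \<in> H} = {h \<in> ?\<Omega>. hist n h \<in> H \<and> fst h (int n) = x}"
      by (auto simp: S1_def S2_def)
    ultimately show ?thesis by (simp add: k_def mult.commute)
  qed
  show ?thesis
    unfolding is_jump_law_def
  proof (intro conjI allI impI ballI)
    show "prob_space (law z)" "sets (law z) = sets (prod_space {0..} {0..})"
      by (rule prob_space_law sets_law)+
    show "AE (w, l) in law z. w 0 = z" by (rule start)
    fix k :: int and H :: "'v path set" and x y and B :: "real set"
    assume "0 \<le> k" and H: "H \<in> sets (prod_space {0..k} {0..<k})" and B: "B \<in> sets borel"
    then obtain n where k: "k = int n" using nonneg_int_cases by blast
    show "measure (law z) {(w, l) \<in> space (law z). restrict_path {0..k} {0..<k} (w, l) \<in> H \<and>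
              w k = x \<and> w (k + 1) = y \<and> l k \<in> B} =
        measure (law z) {(w, l) \<in> space (law z). restrict_path {0..k} {0..<k} (w, l) \<in> H \<and> w k = x}
        * (C x y * exp (u y) / (\<Sum>\<^sub>\<infinity>v\<in>UNIV. C x v * exp (u v)))
        * measure (density lborel (exponential_density (\<beta> x))) B"
      using step[of H n B x y] H B unfolding k p_def[symmetric]
      by (simp add: space_law case_prod_unfold mult.assoc)
  qed
qed

text \<open>Applied to cylinders of the past, the conditional law multiplies the probability of a cylinder by
one factor per step; by induction it determines all cylinder probabilities.\<close>

lemma is_jump_law_unique:
  assumes Q: "is_jump_law C u \<beta> z Q" shows "Q = law z"
proof (rule law_unique)
  show Qp: "prob_space Q" and sQ: "sets Q = sets (prod_space {0..} {0..})"
    using Q by (auto simp: is_jump_law_def)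
  interpret Q: prob_space Q by fact
  let ?\<Omega> = "space (prod_space {0..} {0..}) :: 'v path set"
  have spQ: "space Q = ?\<Omega>" by (rule sets_eq_imp_space_eq[OF sQ])
  have start: "AE h in Q. fst h 0 = z" using Q by (simp add: is_jump_law_def split_beta)
  fix n and x :: "int \<Rightarrow> 'v" and B :: "int \<Rightarrow> real set"
  assume B: "\<And>j. B j \<in> sets borel"
  have "measure Q (ocyl n x B) =
      (if x 0 = z then weight n (\<lambda>i. x (int i)) (\<lambda>i. B (int i)) else 0)"
  proof (induction n)
    case 0
    have s: "ocyl 0 x B \<in> sets Q" unfolding sQ by (rule ocyl_sets[OF B])
    show ?case
    proof (cases "x 0 = z")
      case True
      have "AE h in Q. h \<in> ocyl 0 x B"
        using start AE_space[of Q] unfolding ocyl_alt spQ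
        by eventually_elim (simp add: True)
      then have "measure Q (ocyl 0 x B) = 1" using Q.prob_eq_1[OF s] by simp
      then show ?thesis using True by (simp add: weight_def)
    next
      case False
      have "AE h in Q. h \<notin> ocyl 0 x B"
        using start unfolding ocyl_alt by eventually_elim (use False in auto)
      then have "measure Q (ocyl 0 x B) = 0" using Q.prob_eq_0[OF s] by simp
      then show ?thesis using False by simp
    qed
  next
    case (Suc n)
    have H: "hcyl n x B \<in> sets (prod_space {0..int n} {0..<int n})" by (intro cyl_sets B) auto
    have hh: "h \<in> ?\<Omega> \<and> hist n h \<in> hcyl n x B \<longleftrightarrow> h \<in> ocyl n x B" for h
      using hist_hcyl ocyl_space by blast
    have end_eq: "fst h (int n) = x (int n)" if "h \<in> ocyl n x B" for h
      using that by (simp add: ocyl_alt)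
    have a: "{h \<in> ?\<Omega>. hist n h \<in> hcyl n x B \<and> fst h (int n) = x (int n) \<and>
        fst h (int n + 1) = x (int n + 1) \<and> snd h (int n) \<in> B (int n)} = ocyl (Suc n) x B"
      unfolding ocyl_Suc using hh end_eq by blast
    have b: "{h \<in> ?\<Omega>. hist n h \<in> hcyl n x B \<and> fst h (int n) = x (int n)} = ocyl n x B"
      using hh end_eq by blast
    have "measure Q (ocyl (Suc n) x B) = measure Q (ocyl n x B) *
        p (x (int n)) (x (int n + 1)) * measure (expo (x (int n))) (B (int n))"
      unfolding a[symmetric] b[symmetric] p_def
      using Q[unfolded is_jump_law_def, THEN conjunct2, THEN conjunct2, THEN conjunct2,
          rule_format, of "int n" "hcyl n x B" "B (int n)" "x (int n)" "x (int n + 1)"] H B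
      by (simp add: spQ case_prod_unfold)
    then show ?case unfolding Suc by (simp add: weight_Suc add.commute)
  qed
  then show "emeasure Q (ocyl n x B) =
      (if x 0 = z then ennreal (weight n (\<lambda>i. x (int i)) (\<lambda>i. B (int i))) else 0)"
    by (simp add: Q.emeasure_eq_measure)
qed

lemma jump_law_eq_law: "jump_law C u \<beta> z = law z"
  unfolding jump_law_def using is_jump_law_law is_jump_law_unique by (rule the_equality)

section \<open>The Markov property at the first jump\<close>

abbreviation \<Omega> :: "'v path set" where "\<Omega> \<equiv> space (prod_space {0..} {0..})"

lemma law_start: "AE h in law z. fst h 0 = z"
  using is_jump_law_law[of z] by (simp add: is_jump_law_def split_beta)

text \<open>The shift by one jump of one-sided paths, kept extensional on \<open>{0..}\<close>.\<close>

definition oshift :: "'v path \<Rightarrow> 'v path" where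
  "oshift h = (\<lambda>k\<in>{0..}. fst h (k + 1), \<lambda>k\<in>{0..}. snd h (k + 1))"

lemma measurable_oshift: "oshift \<in> measurable (prod_space {0..} {0..}) (prod_space {0..} {0..})"
proof (rule measurable_into_prod_space)
  show "oshift \<in> \<Omega> \<rightarrow> \<Omega>"
    by (auto simp: space_prod_space oshift_def PiE_def Pi_iff)
qed (auto simp: oshift_def intro!: measurable_vertex measurable_time)

lemma oshift_space: "h \<in> \<Omega> \<Longrightarrow> oshift h \<in> \<Omega>"
  using measurable_space[OF measurable_oshift] .

lemma oshift_apply:
  "0 \<le> k \<Longrightarrow> fst (oshift h) k = fst h (k + 1)" "0 \<le> k \<Longrightarrow> snd (oshift h) k = snd h (k + 1)"
  by (simp_all add: oshift_def)

lemma weight_Suc_shift: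
  "weight (Suc n) x B =
     p (x 0) (x 1) * measure (expo (x 0)) (B 0) * weight n (\<lambda>i. x (Suc i)) (\<lambda>i. B (Suc i))"
  unfolding weight_def by (subst prod.lessThan_Suc_shift) simp

text \<open>Prepending a vertex and a holding time to a cylinder gives a cylinder with one more factor.\<close>

lemma markov_start:
  assumes B: "B \<in> sets borel" and A: "A \<in> sets (prod_space {0..} {0..})"
  shows "emeasure (law x) {h \<in> \<Omega>. fst h 0 = x \<and> snd h 0 \<in> B \<and> fst h 1 = y \<and> oshift h \<in> A} =
    ennreal (p x y * measure (expo x) B) * emeasure (law y) A"
proof -
  let ?P = "prod_space {0..} {0..} :: 'v path measure"
  interpret Q: prob_space "law x" by (rule prob_space_law)
  define S where "S = {h \<in> \<Omega>. fst h 0 = x \<and> snd h 0 \<in> B \<and> fst h 1 = y}"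
  define k where "k = p x y * measure (expo x) B"
  have k: "0 \<le> k" by (simp add: k_def p_nonneg)
  have S: "S \<in> sets (law x)"
  proof -
    note [measurable] = B
    have [measurable]: "(\<lambda>h. fst h 0) \<in> measurable ?P (count_space UNIV)"
      "(\<lambda>h. fst h 1) \<in> measurable ?P (count_space UNIV)" "(\<lambda>h. snd h 0) \<in> borel_measurable ?P"
      by (auto intro!: measurable_vertex measurable_time)
    show ?thesis unfolding S_def sets_law by measurable
  qed
  have sh: "oshift \<in> measurable (law x) ?P"
    using measurable_oshift by (simp add: measurable_cong_sets[OF sets_law refl])
  define M where "M = distr (density (law x) (indicator S)) ?P oshift"
  have M: "emeasure M X = emeasure (law x) (S \<inter> {h \<in> \<Omega>. oshift h \<in> X})" if X: "X \<in> sets ?P" for X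
  proof -
    have "{h \<in> \<Omega>. oshift h \<in> X} = oshift -` X \<inter> space (law x)" by (auto simp: space_law)
    then show ?thesis
      using sh X S measurable_sets[OF sh X] by (simp add: M_def emeasure_distr emeasure_restricted)
  qed
  have "M = scale_measure (ennreal k) (law y)"
  proof (rule prod_space_measure_eqI[where F = "\<lambda>n. {0..int n}" and G = "\<lambda>n. {0..<int n}"])
    have "k \<in> {0..int (nat k)} \<and> k \<in> {0..<int (Suc (nat k))}" if "0 \<le> k" for k
      using that by simp
    then show "(\<Union>n. {0..int n}) = {0..}" "(\<Union>n. {0..<int n}) = {0..}"
      by (fastforce, fastforce)
    fix x' :: "int \<Rightarrow> 'v"
    show "emeasure M (cyl {0..} {0..} {0..int 0} {0..<int 0} x' (\<lambda>_. UNIV)) \<noteq> \<infinity>"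
      unfolding ocyl_def[symmetric]
      by (subst M[OF ocyl_sets]) (simp_all add: Q.emeasure_eq_measure)
    fix n and B' :: "int \<Rightarrow> real set"
    assume B': "\<And>j. B' j \<in> sets borel"
    let ?C = "S \<inter> {h \<in> \<Omega>. oshift h \<in> ocyl n x' B'}"
    have "emeasure M (ocyl n x' B') = emeasure (scale_measure (ennreal k) (law y)) (ocyl n x' B')"
    proof (cases "x' 0 = y")
      case True
      define x'' where "x'' i = (if i = 0 then x else x' (i - 1))" for i
      define B'' where "B'' i = (if i = 0 then B else B' (i - 1))" for i
      have all: "(\<forall>i\<le>Suc n. P i) \<longleftrightarrow> P 0 \<and> (\<forall>i\<le>n. P (Suc i))" for P
        unfolding less_Suc_eq_le[symmetric] by (rule All_less_Suc2)
      have "?C = ocyl (Suc n) x'' B''"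
        unfolding ocyl_alt all All_less_Suc2
        using True by (auto simp: S_def x''_def B''_def oshift_apply add.commute oshift_space)
      moreover have "weight (Suc n) (\<lambda>i. x'' (int i)) (\<lambda>i. B'' (int i)) =
          k * weight n (\<lambda>i. x' (int i)) (\<lambda>i. B' (int i))"
        using True by (simp add: weight_Suc_shift k_def x''_def B''_def)
      moreover have "x'' 0 = x" by (simp add: x''_def)
      moreover have "\<And>j. B'' j \<in> sets borel" using B B' by (simp add: B''_def)
      ultimately show ?thesis
        using True k B' by (simp add: M[OF ocyl_sets] emeasure_law_ocyl ennreal_mult')
    next
      case False
      then have "?C = {}" by (auto simp: S_def ocyl_alt oshift_apply)
      then show ?thesis using False B' by (simp add: M[OF ocyl_sets] emeasure_law_ocyl)
    qed
    then show "emeasure M (cyl {0..} {0..} {0..int n} {0..<int n} x' B') =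
        emeasure (scale_measure (ennreal k) (law y)) (cyl {0..} {0..} {0..int n} {0..<int n} x' B')"
      unfolding ocyl_def .
  qed (auto simp: M_def sets_law countable_vertices incseq_def)
  then have "emeasure M A = ennreal k * emeasure (law y) A" by simp
  moreover have "S \<inter> {h \<in> \<Omega>. oshift h \<in> A} =
      {h \<in> \<Omega>. fst h 0 = x \<and> snd h 0 \<in> B \<and> fst h 1 = y \<and> oshift h \<in> A}"
    by (auto simp: S_def)
  ultimately show ?thesis using M[OF A] by (simp add: k_def)
qed

lemma markov:
  assumes B: "B \<in> sets borel" and A: "A \<in> sets (prod_space {0..} {0..})"
  shows "emeasure (law x) {h \<in> \<Omega>. snd h 0 \<in> B \<and> oshift h \<in> A} =
    (\<integral>\<^sup>+y. ennreal (p x y * measure (expo x) B) * emeasure (law y) A \<partial>count_space UNIV)"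
proof -
  let ?P = "prod_space {0..} {0..} :: 'v path measure"
  define D where "D y = {h \<in> \<Omega>. fst h 0 = x \<and> snd h 0 \<in> B \<and> fst h 1 = y \<and> oshift h \<in> A}" for y
  note [measurable] = A B measurable_oshift
  have [measurable]: "(\<lambda>h. fst h 0) \<in> measurable ?P (count_space UNIV)"
    "(\<lambda>h. fst h 1) \<in> measurable ?P (count_space UNIV)" "(\<lambda>h. snd h 0) \<in> borel_measurable ?P"
    by (auto intro!: measurable_vertex measurable_time)
  have D: "D y \<in> sets (law x)" for y unfolding D_def sets_law by measurable
  have "emeasure (law x) {h \<in> \<Omega>. snd h 0 \<in> B \<and> oshift h \<in> A} = emeasure (law x) (\<Union>y. D y)"
  proof (rule emeasure_eq_AE)
    show "AE h in law x. h \<in> {h \<in> \<Omega>. snd h 0 \<in> B \<and> oshift h \<in> A} \<longleftrightarrow> h \<in> (\<Union>y. D y)"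
      using law_start by eventually_elim (auto simp: D_def)
    show "{h \<in> \<Omega>. snd h 0 \<in> B \<and> oshift h \<in> A} \<in> sets (law x)" unfolding sets_law by measurable
    show "(\<Union>y. D y) \<in> sets (law x)"
      using D countable_vertices by (intro sets.countable_UN'') auto
  qed
  also have "\<dots> = (\<integral>\<^sup>+y. emeasure (law x) (D y) \<partial>count_space UNIV)"
    using D countable_vertices
    by (intro emeasure_UN_countable) (auto simp: disjoint_family_on_def D_def)
  finally show ?thesis unfolding D_def using markov_start[OF B A] by simp
qed

lemma holding_time_independent:
  assumes B: "B \<in> sets borel" and A: "A \<in> sets (prod_space {0..} {0..})"
  shows "emeasure (law x) {h \<in> \<Omega>. snd h 0 \<in> B \<and> oshift h \<in> A} =
    ennreal (measure (expo x) B) * emeasure (law x) {h \<in> \<Omega>. oshift h \<in> A}"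
proof -
  interpret e: prob_space "expo x" by (rule prob_space_expo)
  have m: "measure (expo x) UNIV = 1" using e.prob_space by simp
  have "emeasure (law x) {h \<in> \<Omega>. oshift h \<in> A} =
      (\<integral>\<^sup>+y. ennreal (p x y) * emeasure (law y) A \<partial>count_space UNIV)"
    using markov[of UNIV A x] A by (simp add: m)
  then show ?thesis
    unfolding markov[OF B A]
    by (simp add: nn_integral_cmult[symmetric] ennreal_mult p_nonneg ac_simps)
qed

lemma borel_UNIV: "UNIV \<in> sets (borel :: real measure)" by simp

lemma null_after_step:
  assumes A: "A \<in> sets (prod_space {0..} {0..})" and "\<And>y. emeasure (law y) A = 0"
  shows "emeasure (law x) {h \<in> \<Omega>. oshift h \<in> A} = 0"
  using markov[of UNIV A x] assms by simp

text \<open>A step of positive probability carries null sets of the law from \<open>x\<close> to null sets of the law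
from \<open>y\<close>; this propagates transience along edges.\<close>

lemma null_before_step:
  assumes A: "A \<in> sets (prod_space {0..} {0..})" and xy: "0 < p x y"
    and null: "emeasure (law x) {h \<in> \<Omega>. oshift h \<in> A} = 0"
  shows "emeasure (law y) A = 0"
proof -
  interpret e: prob_space "expo x" by (rule prob_space_expo)
  have m: "measure (expo x) UNIV = 1" using e.prob_space by simp
  have "emeasure (law x) {h \<in> \<Omega>. fst h 0 = x \<and> snd h 0 \<in> UNIV \<and> fst h 1 = y \<and> oshift h \<in> A} \<le>
      emeasure (law x) {h \<in> \<Omega>. oshift h \<in> A}"
    using measurable_sets[OF measurable_oshift A]
    by (intro emeasure_mono) (auto simp: sets_law vimage_def Int_def conj_commute)
  then have "ennreal (p x y) * emeasure (law y) A = 0"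
    unfolding markov_start[OF borel_UNIV A] null by (simp add: m)
  then show ?thesis using xy by simp
qed

section \<open>Transience and escape from finite sets\<close>

lemma measurable_vertex_cylinder:
  assumes "k \<in> I"
  shows "{h \<in> space (prod_space I J). P (fst h k)} \<in> sets (prod_space I J :: 'v path measure)"
  using measurable_sets[OF measurable_vertex[OF assms, of J], of "Collect P"]
  by (simp add: vimage_def Int_def conj_commute)

lemma measurable_vertex_pair:
  assumes "k \<in> I" "k' \<in> I"
  shows "{h \<in> space (prod_space I J). P (fst h k) (fst h k')} \<in> sets (prod_space I J :: 'v path measure)"
proof -
  have "{h \<in> space (prod_space I J). P (fst h k) (fst h k')} =
      (\<Union>y\<in>UNIV. {h \<in> space (prod_space I J). P (fst h k) y} \<inter> {h \<in> space (prod_space I J). fst h k' = y})"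
    by auto
  also have "\<dots> \<in> sets (prod_space I J :: 'v path measure)"
    using countable_vertices assms
    by (intro sets.countable_UN'' sets.Int) (auto intro!: measurable_vertex_cylinder[where P = "\<lambda>x. P x _"] measurable_vertex_cylinder)
  finally show ?thesis .
qed

lemma hatW_alt:
  "hatW E I = {h \<in> space (prod_space I I). (\<forall>k. k \<in> I \<and> k + 1 \<in> I \<longrightarrow> {fst h k, fst h (k + 1)} \<in> E) \<and>
     (\<forall>j\<in>UNIV. finite {k \<in> I. fst h k = j})}"
  by (auto simp: hatW_def W_def space_prod_space)

lemma finite_visits_measurable:
  "{h \<in> space (prod_space I J). finite {k \<in> I. fst h k = j}} \<in> sets (prod_space I J :: 'v path measure)"
proof -
  have "{h \<in> space (prod_space I J). finite {k \<in> I. fst h k = j}} =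
      {h \<in> space (prod_space I J :: 'v path measure). \<exists>N::int. \<forall>k::int. k \<in> I \<longrightarrow> fst h k = j \<longrightarrow> \<bar>k\<bar> \<le> N}"
    unfolding finite_int_iff_bounded_le by (auto simp: image_subset_iff)
  also have "\<dots> \<in> sets (prod_space I J)"
  proof (intro sets.sets_Collect_countable_Ex sets.sets_Collect_countable_All)
    fix N k :: int
    show "{h \<in> space (prod_space I J). k \<in> I \<longrightarrow> fst h k = j \<longrightarrow> \<bar>k\<bar> \<le> N} \<in> sets (prod_space I J :: 'v path measure)"
      using measurable_vertex_cylinder[of k I J "\<lambda>x. x = j \<longrightarrow> \<bar>k\<bar> \<le> N"] by (cases "k \<in> I") auto
  qed
  finally show ?thesis .
qed

lemma all_visits_finite_measurable:
  "{h \<in> space (prod_space I J). \<forall>j\<in>UNIV. finite {k \<in> I. fst h k = j}}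
    \<in> sets (prod_space I J :: 'v path measure)"
proof -
  let ?S = "space (prod_space I J) :: 'v path set"
  have "{h \<in> ?S. \<forall>j\<in>UNIV. finite {k \<in> I. fst h k = j}} =
      ?S - (\<Union>j\<in>UNIV. ?S - {h \<in> ?S. finite {k \<in> I. fst h k = j}})"
    by auto
  also have "\<dots> \<in> sets (prod_space I J)"
    by (intro sets.Diff sets.top sets.countable_UN'' countable_vertices finite_visits_measurable)
  finally show ?thesis .
qed

lemma hatW_sets: "hatW E I \<in> sets (prod_space I I)"
  unfolding hatW_alt
proof (intro sets.sets_Collect_conj sets.sets_Collect_countable_All all_visits_finite_measurable)
  fix k :: int
  show "{h \<in> space (prod_space I I). k \<in> I \<and> k + 1 \<in> I \<longrightarrow> {fst h k, fst h (k + 1)} \<in> E}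
      \<in> sets (prod_space I I :: 'v path measure)"
    using measurable_vertex_pair[of k I "k + 1" I "\<lambda>x y. {x, y} \<in> E"] by (cases "k \<in> I \<and> k + 1 \<in> I") auto
qed

lemma AE_law_edge: "AE h in law x. {fst h (int k), fst h (int k + 1)} \<in> E"
proof (induction k arbitrary: x)
  case 0
  have "AE h in law x. \<forall>y\<in>UNIV. {x, y} \<notin> E \<longrightarrow> \<not> (fst h 0 = x \<and> fst h 1 = y)"
  proof (subst AE_ball_countable[OF countable_vertices], intro ballI)
    fix y
    let ?N = "{h \<in> \<Omega>. fst h 0 = x \<and> snd h 0 \<in> UNIV \<and> fst h 1 = y \<and> oshift h \<in> \<Omega>}"
    show "AE h in law x. {x, y} \<notin> E \<longrightarrow> \<not> (fst h 0 = x \<and> fst h 1 = y)"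
    proof (cases "{x, y} \<in> E")
      case False
      have "?N = {h \<in> \<Omega>. fst h 0 = x \<and> fst h 1 = y}" using oshift_space by auto
      then have "?N \<in> sets (law x)"
        using measurable_vertex_pair[of 0 "{0..}" 1 "{0..}" "\<lambda>a b. a = x \<and> b = y"] by (simp add: sets_law)
      moreover have "emeasure (law x) ?N = 0"
        using markov_start[of UNIV \<Omega> x y] p_nonedge[OF False] by simp
      ultimately have "AE h in law x. h \<notin> ?N" by (intro AE_not_in null_setsI)
      with AE_space show ?thesis by eventually_elim (auto simp: space_law oshift_space)
    qed simp
  qed
  with law_start[of x] show ?case by eventually_elim auto
next
  case (Suc k)
  let ?A = "{h \<in> \<Omega>. {fst h (int k), fst h (int k + 1)} \<notin> E}"
  have A: "?A \<in> sets (prod_space {0..} {0..})"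
    using measurable_vertex_pair[of "int k" "{0..}" "int k + 1" "{0..}" "\<lambda>a b. {a, b} \<notin> E"] by simp
  have "emeasure (law y) ?A = 0" for y
    using Suc[of y] A by (subst (asm) AE_iff_measurable[OF _ refl]) (auto simp: space_law sets_law)
  then have "emeasure (law x) {h \<in> \<Omega>. oshift h \<in> ?A} = 0" by (rule null_after_step[OF A])
  moreover have "{h \<in> \<Omega>. oshift h \<in> ?A} \<in> sets (law x)"
    using measurable_sets[OF measurable_oshift A] by (simp add: sets_law vimage_def Int_def conj_commute)
  ultimately have "AE h in law x. h \<notin> {h \<in> \<Omega>. oshift h \<in> ?A}" by (intro AE_not_in null_setsI)
  with AE_space[of "law x"] show ?case
    by eventually_elim (auto simp: space_law oshift_space oshift_apply add.commute add.left_commute)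
qed

lemma finite_visits_oshift:
  assumes "finite {k \<in> {0..}. fst h k = j}"
  shows "finite {k \<in> {0..}. fst (oshift h) k = j}"
proof (rule finite_surj[OF assms])
  show "{k \<in> {0..}. fst (oshift h) k = j} \<subseteq> (\<lambda>k. k - 1) ` {k \<in> {0..}. fst h k = j}"
  proof
    fix k assume "k \<in> {k \<in> {0..}. fst (oshift h) k = j}"
    then show "k \<in> (\<lambda>k. k - 1) ` {k \<in> {0..}. fst h k = j}"
      by (intro image_eqI[of _ _ "k + 1"]) (auto simp: oshift_apply)
  qed
qed

text \<open>The first step preserves the finiteness of visits, so the set of non-transient paths is null
from a neighbour as soon as it is null from a vertex. Connectedness does the rest.\<close>

lemma transient_from_everywhere:
  assumes "transient_law (law x0)"
  shows "AE h in law x. \<forall>j\<in>UNIV. finite {k \<in> {0..}. fst h k = j}"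
proof -
  define N where "N = {h \<in> \<Omega>. \<not> (\<forall>j\<in>UNIV. finite {k \<in> {0..}. fst h k = j})}"
  have N: "N \<in> sets (prod_space {0..} {0..})"
    unfolding N_def
    by (intro sets.sets_Collect_neg all_visits_finite_measurable)
  have AE_N: "(AE h in law y. \<forall>j\<in>UNIV. finite {k \<in> {0..}. fst h k = j}) \<longleftrightarrow> emeasure (law y) N = 0" for y
    using N by (subst AE_iff_measurable[where N = N]) (auto simp: N_def space_law sets_law)
  have "(x0, x) \<in> {(a, b). {a, b} \<in> E}\<^sup>*" using graph by (simp add: conductance_graph_def)
  then have "emeasure (law x) N = 0"
  proof (induction rule: rtrancl_induct)
    case base
    show ?case using assms unfolding AE_N[symmetric] by (simp add: transient_law_def split_beta)
  next
    case (step y z)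
    have sub: "{h \<in> \<Omega>. oshift h \<in> N} \<subseteq> N"
    proof
      fix h assume h: "h \<in> {h \<in> \<Omega>. oshift h \<in> N}"
      then obtain j where j: "infinite {k \<in> {0..}. fst (oshift h) k = j}" by (auto simp: N_def)
      have "infinite {k \<in> {0..}. fst h k = j}"
        using finite_visits_oshift j by blast
      then show "h \<in> N" using h by (auto simp: N_def)
    qed
    have "emeasure (law y) {h \<in> \<Omega>. oshift h \<in> N} \<le> emeasure (law y) N"
      using N by (intro emeasure_mono sub) (simp add: sets_law)
    then have "emeasure (law y) {h \<in> \<Omega>. oshift h \<in> N} = 0" using step by simp
    then show ?case using step by (intro null_before_step[OF N p_edge]) auto
  qed
  then show ?thesis unfolding AE_N .
qed

lemma AE_law_hatW:
  assumes "transient_law (law x0)"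
  shows "AE h in law x. h \<in> hatW E {0..}"
proof -
  have "AE h in law x. \<forall>k. {fst h (int k), fst h (int k + 1)} \<in> E"
    using AE_law_edge by (simp add: AE_all_countable)
  then show ?thesis
    using transient_from_everywhere[OF assms, of x] AE_space
  proof eventually_elim
    case (elim h)
    have "{fst h k, fst h (k + 1)} \<in> E" if "0 \<le> k" for k
      using elim(1)[rule_format, of "nat k"] that by simp
    then show ?case using elim(2,3) by (simp add: hatW_alt space_law)
  qed
qed

lemma escape_set_alt:
  "escape_set E K = {h \<in> hatW E {0..}. fst h 0 \<in> K \<and> (\<forall>k>0. fst h k \<notin> K)}"
  by (auto simp: escape_set_def)

lemma escape_set_sets: "escape_set E K \<in> sets (prod_space {0..} {0..})"
proof -
  have "escape_set E K = hatW E {0..} \<inter> {h \<in> \<Omega>. fst h 0 \<in> K \<and> (\<forall>k. k > 0 \<longrightarrow> fst h k \<notin> K)}"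
    using sets.sets_into_space[OF hatW_sets[of "{0..}"]] by (auto simp: escape_set_alt)
  also have "\<dots> \<in> sets (prod_space {0..} {0..})"
  proof (intro sets.Int hatW_sets sets.sets_Collect_conj)
    show "{h \<in> \<Omega>. fst h 0 \<in> K} \<in> sets (prod_space {0..} {0..})"
      by (rule measurable_vertex_cylinder) simp
    have "{h \<in> \<Omega>. 0 < k \<longrightarrow> fst h k \<notin> K} \<in> sets (prod_space {0..} {0..})" for k
      using measurable_vertex_cylinder[of k "{0..}" "{0..}" "\<lambda>x. x \<notin> K"] by (cases "0 < k") auto
    then show "{h \<in> \<Omega>. \<forall>k>0. fst h k \<notin> K} \<in> sets (prod_space {0..} {0..})"
      by (rule sets.sets_Collect_countable_All)
  qed
  finally show ?thesis .
qed

lemma iterated_oshift_apply: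
  "0 \<le> k \<Longrightarrow> fst ((oshift ^^ m) h) k = fst h (k + int m)"
  by (induction m arbitrary: k) (simp_all add: oshift_apply ac_simps)

lemma oshift_hatW: "h \<in> hatW E {0..} \<Longrightarrow> oshift h \<in> hatW E {0..}"
proof -
  assume h: "h \<in> hatW E {0..}"
  have "finite {k \<in> {0..}. fst (oshift h) k = j}" for j
    using h by (intro finite_visits_oshift) (simp add: hatW_alt)
  then show ?thesis
    using h by (auto simp: hatW_alt oshift_space oshift_apply ac_simps)
qed

text \<open>Otherwise escaping would be impossible from every vertex, hence, by the Markov property, also
after any number of steps. But a path that starts in \<open>K\<close> and visits \<open>K\<close> finitely often escapes
after its last visit.\<close>

lemma escape_pos:
  assumes tr: "transient_law (law x0)" and K: "finite K" "K \<noteq> {}"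
  shows "\<exists>x\<in>K. emeasure (law x) (escape_set E K) > 0"
proof (rule ccontr)
  assume "\<not> ?thesis"
  then have esc0: "emeasure (law x) (escape_set E K) = 0" if "x \<in> K" for x using that by auto
  define A where "A n = {h \<in> \<Omega>. (oshift ^^ n) h \<in> escape_set E K}" for n
  have sh: "(oshift ^^ n) \<in> measurable (prod_space {0..} {0..}) (prod_space {0..} {0..})" for n
    by (induction n) (simp_all add: measurable_compose[OF _ measurable_oshift] comp_def)
  have A: "A n \<in> sets (prod_space {0..} {0..})" for n
    using measurable_sets[OF sh escape_set_sets, of n K]
    by (simp add: A_def vimage_def Int_def conj_commute)
  have null: "emeasure (law x) (A n) = 0" for x n
  proof (induction n arbitrary: x)
    case 0
    have "A 0 = escape_set E K"
      using sets.sets_into_space[OF escape_set_sets[of K]] by (auto simp: A_def)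
    moreover have "emeasure (law x) (escape_set E K) = 0" if "x \<notin> K"
    proof -
      have "AE h in law x. h \<notin> escape_set E K"
        using law_start[of x] by eventually_elim (use that in \<open>auto simp: escape_set_alt\<close>)
      then show ?thesis
        by (subst (asm) AE_iff_measurable[OF _ refl])
           (auto simp: space_law sets_law escape_set_sets Collect_conj_eq Int_absorb1
              sets.sets_into_space[OF escape_set_sets, simplified])
    qed
    ultimately show ?case using esc0 by auto
  next
    case (Suc n)
    have "A (Suc n) = {h \<in> \<Omega>. oshift h \<in> A n}"
      by (auto simp: A_def funpow_swap1 oshift_space)
    then show ?case using null_after_step[OF A Suc] by simp
  qed
  obtain x where x: "x \<in> K" using K by auto
  interpret Q: prob_space "law x" by (rule prob_space_law)
  have "AE h in law x. \<forall>n. h \<notin> A n"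
    using A null by (simp add: AE_all_countable AE_not_in null_setsI sets_law)
  with AE_law_hatW[OF tr, of x] law_start[of x] have "AE h in law x. False"
  proof eventually_elim
    case (elim h)
    let ?T = "{k \<in> {0..}. fst h k \<in> K}"
    have "?T = (\<Union>j\<in>K. {k \<in> {0..}. fst h k = j})" by auto
    then have fin: "finite ?T" using K elim(1) by (simp add: hatW_alt)
    have ne: "0 \<in> ?T" using elim(2) x by simp
    \<comment> \<open>the time of the last visit to \<open>K\<close>, which exists since \<open>h\<close> visits \<open>K\<close> finitely often\<close>
    define m where "m = nat (Max ?T)"
    have M: "Max ?T \<in> ?T" using Max_in[OF fin] ne by blast
    then have m: "int m = Max ?T" by (simp add: m_def)
    have "fst h k \<notin> K" if "int m < k" for k
      using Max_ge[OF fin, of k] that M unfolding m by auto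
    moreover have "(oshift ^^ m) h \<in> hatW E {0..}"
      using elim(1) by (induction m) (auto intro: oshift_hatW)
    ultimately have "(oshift ^^ m) h \<in> escape_set E K"
      using M unfolding m[symmetric] by (simp add: escape_set_alt iterated_oshift_apply)
    moreover have "h \<in> \<Omega>" using elim(1) by (simp add: hatW_alt)
    ultimately show ?case using elim(3) by (auto simp: A_def)
  qed
  then show False by simp
qed

section \<open>The stationary measure on two_sided-sided paths\<close>

abbreviation path_space :: "'v path measure" where "path_space \<equiv> prod_space UNIV UNIV"

lemma space_path_space: "space path_space = UNIV \<times> (UNIV \<rightarrow> {0<..})"
  by (simp add: space_prod_space PiE_def)

text \<open>The path \<open>g\<close> becomes the past, read backwards, and \<open>h\<close> the future. The state and the holding
time at time 0 come from \<open>h\<close>; those of \<open>g\<close> are discarded.\<close>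

definition glue :: "'v path \<times> 'v path \<Rightarrow> 'v path" where
  "glue = (\<lambda>(g, h). (\<lambda>k. if 0 \<le> k then fst h k else fst g (- k),
                     \<lambda>k. if 0 \<le> k then snd h k else snd g (- k)))"

lemma glue_apply:
  "0 \<le> k \<Longrightarrow> fst (glue (g, h)) k = fst h k" "0 \<le> k \<Longrightarrow> snd (glue (g, h)) k = snd h k"
  "k < 0 \<Longrightarrow> fst (glue (g, h)) k = fst g (- k)" "k < 0 \<Longrightarrow> snd (glue (g, h)) k = snd g (- k)"
  by (simp_all add: glue_def)

lemma measurable_glue: "glue \<in> measurable (law z \<Otimes>\<^sub>M law z) path_space"
proof (rule measurable_into_prod_space)
  show "glue \<in> space (law z \<Otimes>\<^sub>M law z) \<rightarrow> space path_space"
    by (auto simp: space_pair_measure space_law space_path_space glue_def space_prod_space PiE_def Pi_iff)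
  fix k :: int
  have v: "(\<lambda>h. fst h j) \<in> measurable (law z) (count_space UNIV)"
    and t: "(\<lambda>h. snd h j) \<in> borel_measurable (law z)" if "0 \<le> j" for j
    using measurable_vertex[of j "{0..}" "{0..}"] measurable_time[of j "{0..}" "{0..}"] that
    by (simp_all add: measurable_cong_sets[OF sets_law refl])
  show "(\<lambda>x. fst (glue x) k) \<in> measurable (law z \<Otimes>\<^sub>M law z) (count_space UNIV)"
    using measurable_compose[OF measurable_snd v[of k]] measurable_compose[OF measurable_fst v[of "- k"]]
    by (cases "0 \<le> k") (simp_all add: glue_def case_prod_unfold)
  show "(\<lambda>x. snd (glue x) k) \<in> borel_measurable (law z \<Otimes>\<^sub>M law z)"
    using measurable_compose[OF measurable_snd t[of k]] measurable_compose[OF measurable_fst t[of "- k"]]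
    by (cases "0 \<le> k") (simp_all add: glue_def case_prod_unfold)
qed

definition two_sided :: "'v \<Rightarrow> 'v path measure" where
  "two_sided z = distr (law z \<Otimes>\<^sub>M law z) path_space glue"

text \<open>A mixture of probability measures with the weights \<open>c\<close>, of infinite total mass in general; the
monadic bind also works for an infinite mixing measure.\<close>

definition mu :: "'v path measure" where
  "mu = density (count_space UNIV) (\<lambda>z. ennreal (c z)) \<bind> two_sided"

lemma prob_space_two_sided: "prob_space (two_sided z)"
  unfolding two_sided_def
  by (intro prob_space.prob_space_distr prob_space_pair prob_space_law measurable_glue)

lemma sets_two_sided: "sets (two_sided z) = sets path_space" by (simp add: two_sided_def)

lemma two_sided_kernel: "two_sided \<in> measurable (density (count_space UNIV) (\<lambda>z. ennreal (c z))) (subprob_algebra path_space)"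
  using prob_space_two_sided sets_two_sided
  by (auto simp: measurable_def space_subprob_algebra prob_space_imp_subprob_space)

lemma sets_mu: "sets mu = sets path_space"
  unfolding mu_def by (rule sets_bind[OF sets_two_sided]) auto

lemma space_mu: "space mu = space path_space"
  by (rule sets_eq_imp_space_eq[OF sets_mu])

lemma emeasure_mu:
  assumes "A \<in> sets path_space"
  shows "emeasure mu A = (\<integral>\<^sup>+z. ennreal (c z) * emeasure (two_sided z) A \<partial>count_space UNIV)"
  unfolding mu_def by (subst emeasure_bind[OF _ two_sided_kernel assms]) (auto simp: nn_integral_density)

lemma emeasure_mu_from:
  assumes A: "A \<in> sets path_space" and "\<And>z. z \<noteq> x \<Longrightarrow> emeasure (two_sided z) A = 0"
  shows "emeasure mu A = ennreal (c x) * emeasure (two_sided x) A"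
  unfolding emeasure_mu[OF A] using assms(2)
  by (subst nn_integral_count_space'[of "{x}"]) auto

text \<open>Both halves start at \<open>z\<close> almost surely, so a set of glued paths need only be a product where the
two halves agree at time 0.\<close>

lemma emeasure_two_sided:
  assumes A: "A \<in> sets path_space" and Y: "Y1 \<in> sets (law z)" "Y2 \<in> sets (law z)"
    and iff: "\<And>g h. g \<in> \<Omega> \<Longrightarrow> h \<in> \<Omega> \<Longrightarrow> fst g 0 = z \<Longrightarrow> fst h 0 = z \<Longrightarrow>
      glue (g, h) \<in> A \<longleftrightarrow> g \<in> Y1 \<and> h \<in> Y2"
  shows "emeasure (two_sided z) A = emeasure (law z) Y1 * emeasure (law z) Y2"
proof -
  interpret Q: prob_space "law z" by (rule prob_space_law)
  interpret QQ: pair_prob_space "law z" "law z" ..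
  have "AE \<omega> in law z \<Otimes>\<^sub>M law z. \<omega> \<in> glue -` A \<inter> space (law z \<Otimes>\<^sub>M law z) \<longleftrightarrow> \<omega> \<in> Y1 \<times> Y2"
  proof -
    have st: "{h \<in> \<Omega>. fst h 0 = z} \<in> sets (law z)"
      unfolding sets_law by (rule measurable_vertex_cylinder) simp
    have "{\<omega> \<in> space (law z \<Otimes>\<^sub>M law z). fst (fst \<omega>) 0 = z \<and> fst (snd \<omega>) 0 = z} =
        {h \<in> \<Omega>. fst h 0 = z} \<times> {h \<in> \<Omega>. fst h 0 = z}"
      by (auto simp: space_pair_measure space_law)
    then have "AE \<omega> in law z \<Otimes>\<^sub>M law z. fst (fst \<omega>) 0 = z \<and> fst (snd \<omega>) 0 = z"
      using st law_start[of z] by (intro QQ.AE_pair_measure) (auto elim!: eventually_mono)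
    with AE_space show ?thesis
    proof eventually_elim
      case (elim \<omega>)
      then show ?case using iff[of "fst \<omega>" "snd \<omega>"]
        by (auto simp: space_pair_measure space_law mem_Times_iff)
    qed
  qed
  then have "emeasure (two_sided z) A = emeasure (law z \<Otimes>\<^sub>M law z) (Y1 \<times> Y2)"
    unfolding two_sided_def emeasure_distr[OF measurable_glue A]
    using Y measurable_sets[OF measurable_glue A] by (intro emeasure_eq_AE) auto
  then show ?thesis by (simp add: Q.emeasure_pair_measure_Times Y)
qed

lemma emeasure_two_sided_null:
  assumes A: "A \<in> sets path_space" and "\<And>h. h \<in> A \<Longrightarrow> fst h 0 \<noteq> z"
  shows "emeasure (two_sided z) A = 0"
proof -
  have "glue (g, h) \<notin> A" if "fst h 0 = z" for g h
    using assms(2)[of "glue (g, h)"] that by (auto simp: glue_apply)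
  then show ?thesis by (subst emeasure_two_sided[OF A, of "{}" z "{}"]) auto
qed

abbreviation tcyl :: "int \<Rightarrow> int \<Rightarrow> (int \<Rightarrow> 'v) \<Rightarrow> (int \<Rightarrow> real set) \<Rightarrow> 'v path set" where
  "tcyl a b \<equiv> cyl UNIV UNIV {a..b} {a<..<b}"

lemma tcyl_sets: "(\<And>j. B j \<in> sets borel) \<Longrightarrow> tcyl a b x B \<in> sets path_space"
  by (rule cyl_sets) auto

text \<open>The holding time at time 0 of the backward half is discarded, hence the factor \<open>UNIV\<close> at index 0.
For \<open>m = 0\<close> the open interval would leave out time 0, whose holding time belongs to the forward half.\<close>

lemma emeasure_mu_tcyl:
  assumes B: "\<And>j. B j \<in> sets borel" and m: "0 < m"
  shows "emeasure mu (tcyl (- int m) (int n) x B) =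
    ennreal (c (x 0) * weight m (\<lambda>i. x (- int i)) (\<lambda>i. if i = 0 then UNIV else B (- int i))
       * weight n (\<lambda>i. x (int i)) (\<lambda>i. B (int i)))"
proof -
  let ?A = "tcyl (- int m) (int n) x B"
  define x' where "x' i = x (- i)" for i
  define B' where "B' i = (if i = 0 then UNIV else B (- i))" for i
  have B': "B' j \<in> sets borel" for j using B by (simp add: B'_def)
  have A: "?A \<in> sets path_space" by (rule tcyl_sets[OF B])
  have "emeasure (two_sided (x 0)) ?A = emeasure (law (x 0)) (ocyl m x' B') * emeasure (law (x 0)) (ocyl n x B)"
  proof (rule emeasure_two_sided[OF A])
    fix g h assume gh: "g \<in> \<Omega>" "h \<in> \<Omega>" "fst g 0 = x 0" "fst h 0 = x 0"
    then have sp: "glue (g, h) \<in> space path_space"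
      using measurable_space[OF measurable_glue, of "(g, h)" "x 0"]
      by (simp add: space_pair_measure space_law)
    let ?w = "fst (glue (g, h))" and ?l = "snd (glue (g, h))"
    have w: "(\<forall>i\<in>{- int m..int n}. ?w i = x i) \<longleftrightarrow>
        (\<forall>i\<in>{0..int m}. fst g i = x' i) \<and> (\<forall>i\<in>{0..int n}. fst h i = x i)" (is "?L \<longleftrightarrow> ?R")
    proof
      assume L: ?L
      have "fst g i = x' i" if "i \<in> {0..int m}" for i
        using L[rule_format, of "- i"] that gh by (cases "i = 0") (auto simp: glue_apply x'_def)
      moreover have "fst h i = x i" if "i \<in> {0..int n}" for i
        using L[rule_format, of i] that by (auto simp: glue_apply)
      ultimately show ?R by blast
    next
      assume R: ?R
      show ?L
      proof
        fix i assume i: "i \<in> {- int m..int n}"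
        show "?w i = x i"
          using R[THEN conjunct1, rule_format, of "- i"] R[THEN conjunct2, rule_format, of i] i
          by (cases "0 \<le> i") (auto simp: glue_apply x'_def)
      qed
    qed
    have l: "(\<forall>i\<in>{- int m<..<int n}. ?l i \<in> B i) \<longleftrightarrow>
        (\<forall>i\<in>{0..<int m}. snd g i \<in> B' i) \<and> (\<forall>i\<in>{0..<int n}. snd h i \<in> B i)" (is "?L \<longleftrightarrow> ?R")
    proof
      assume L: ?L
      have "snd g i \<in> B' i" if "i \<in> {0..<int m}" for i
        using L[rule_format, of "- i"] that gh by (cases "i = 0") (auto simp: glue_apply B'_def)
      moreover have "snd h i \<in> B i" if "i \<in> {0..<int n}" for i
        using L[rule_format, of i] that m by (auto simp: glue_apply)
      ultimately show ?R by blast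
    next
      assume R: ?R
      show ?L
      proof
        fix i assume i: "i \<in> {- int m<..<int n}"
        show "?l i \<in> B i"
          using R[THEN conjunct1, rule_format, of "- i"] R[THEN conjunct2, rule_format, of i] i
          by (cases "0 \<le> i") (auto simp: glue_apply B'_def)
      qed
    qed
    show "glue (g, h) \<in> ?A \<longleftrightarrow> g \<in> ocyl m x' B' \<and> h \<in> ocyl n x B"
      using gh sp w l unfolding ocyl_def cyl_def by blast
  qed (simp_all add: sets_law ocyl_sets B B')
  moreover have "emeasure mu ?A = ennreal (c (x 0)) * emeasure (two_sided (x 0)) ?A"
    by (rule emeasure_mu_from[OF A emeasure_two_sided_null[OF A]]) (auto simp: cyl_def)
  ultimately show ?thesis
    using c_pos[of "x 0"] B B'
    by (simp add: emeasure_law_ocyl ennreal_mult weight_nonneg x'_def B'_def mult.assoc)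
qed

definition time_shift :: "int \<Rightarrow> 'v path \<Rightarrow> 'v path" where
  "time_shift m h = (\<lambda>k. fst h (k + m), \<lambda>k. snd h (k + m))"

lemma shift_apply [simp]: "fst (time_shift m h) k = fst h (k + m)" "snd (time_shift m h) k = snd h (k + m)"
  by (simp_all add: time_shift_def)

lemma shift_shift [simp]: "time_shift m (time_shift n h) = time_shift (m + n) h"
  by (simp add: time_shift_def ac_simps)

lemma shift_0 [simp]: "time_shift 0 h = h"
  by (simp add: time_shift_def)

lemma measurable_shift: "time_shift m \<in> measurable path_space path_space"
  by (rule measurable_into_prod_space)
     (auto simp: space_path_space time_shift_def Pi_iff intro!: measurable_vertex measurable_time)

lemma vimage_shift_tcyl:
  "time_shift 1 -` tcyl a b x B \<inter> space path_space = tcyl (a + 1) (b + 1) (\<lambda>k. x (k - 1)) (\<lambda>k. B (k - 1))"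
proof -
  have re: "(\<forall>i\<in>S. P i) \<longleftrightarrow> (\<forall>i\<in>T. P (i - 1))" if "\<And>i. i \<in> S \<longleftrightarrow> i + 1 \<in> T"
    for P and S T :: "int set"
    using that by (metis add_diff_cancel_right' diff_add_cancel)
  have 1: "(\<forall>i\<in>{a..b}. P i) \<longleftrightarrow> (\<forall>i\<in>{a + 1..b + 1}. P (i - 1))" for P
    by (rule re) auto
  have 2: "(\<forall>i\<in>{a<..<b}. P i) \<longleftrightarrow> (\<forall>i\<in>{a + 1<..<b + 1}. P (i - 1))" for P
    by (rule re) auto
  show ?thesis
    unfolding cyl_def 1 2 using measurable_space[OF measurable_shift] by auto
qed

text \<open>Shifting a cylinder moves one jump from the backward to the forward half: the factor
\<open>c (x 0) * p (x 0) (x (- 1))\<close> turns into \<open>c (x (- 1)) * p (x (- 1)) (x 0)\<close>, which is the same by detailed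
balance. The holding time at \<open>- 1\<close>, the new origin, moves with it. The cylinders used
start at time \<open>- 2\<close> or earlier, so that the shifted ones still start before time 0.\<close>

lemma mu_shift_1: "distr mu path_space (time_shift 1) = mu"
proof (rule sym, rule prod_space_measure_eqI[where F = "\<lambda>n. {- int (n + 2)..int (n + 2)}"
      and G = "\<lambda>n. {- int (n + 2)<..<int (n + 2)}"])
  have sh: "time_shift 1 \<in> measurable mu path_space"
    using measurable_shift by (simp add: measurable_cong_sets[OF sets_mu refl])
  fix n :: nat and x and B :: "int \<Rightarrow> real set" assume B: "\<And>j. B j \<in> sets borel"
  let ?m = "n + 2"
  have "emeasure (distr mu path_space (time_shift 1)) (tcyl (- int ?m) (int ?m) x B) =
      emeasure mu (tcyl (- int (Suc n)) (int (Suc ?m)) (\<lambda>k. x (k - 1)) (\<lambda>k. B (k - 1)))"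
  proof -
    have "- int ?m + 1 = - int (Suc n)" "int ?m + 1 = int (Suc ?m)" by auto
    then show ?thesis
      unfolding emeasure_distr[OF sh tcyl_sets[OF B]] space_mu vimage_shift_tcyl by presburger
  qed
  also have "\<dots> = emeasure mu (tcyl (- int ?m) (int ?m) x B)"
  proof -
    let ?x = "\<lambda>i. x (- 1 - int i)" and ?B = "\<lambda>i. B (- 1 - int i)"
    have U: "measure (expo y) UNIV = 1" for y
      using prob_space.prob_space[OF prob_space_expo[of y]] by simp
    have 1: "weight (Suc n) ?x ?B =
        measure (expo (x (-1))) (B (-1)) * weight (Suc n) ?x (\<lambda>i. if i = 0 then UNIV else ?B i)"
      by (simp add: weight_Suc_shift U)
    have 2: "weight ?m (\<lambda>i. x (- int i)) (\<lambda>i. if i = 0 then UNIV else B (- int i)) =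
        p (x 0) (x (-1)) * weight (Suc n) ?x ?B"
      by (simp only: add_2_eq_Suc' weight_Suc_shift[of "Suc n"]) (simp add: U)
    have 3: "weight (Suc ?m) (\<lambda>i. x (int i - 1)) (\<lambda>i. B (int i - 1)) =
        p (x (-1)) (x 0) * measure (expo (x (-1))) (B (-1)) * weight ?m (\<lambda>i. x (int i)) (\<lambda>i. B (int i))"
      by (simp only: weight_Suc_shift[of ?m]) simp
    have "c (x (-1)) * weight (Suc n) ?x (\<lambda>i. if i = 0 then UNIV else ?B i) *
          weight (Suc ?m) (\<lambda>i. x (int i - 1)) (\<lambda>i. B (int i - 1)) =
        c (x 0) * weight ?m (\<lambda>i. x (- int i)) (\<lambda>i. if i = 0 then UNIV else B (- int i)) *
          weight ?m (\<lambda>i. x (int i)) (\<lambda>i. B (int i))"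
      unfolding 1 2 3 using detailed_balance[of "x (-1)" "x 0"] by (simp add: mult.assoc)
    moreover have "- int i - 1 = - 1 - int i" for i by simp
    then have "(\<lambda>i. x (- int i - 1)) = ?x"
      "(\<lambda>i. if i = 0 then UNIV else B (- int i - 1)) = (\<lambda>i. if i = 0 then UNIV else ?B i)"
      by (simp_all only:)
    moreover note L = emeasure_mu_tcyl[of "\<lambda>k. B (k - 1)" "Suc n" "Suc ?m" "\<lambda>k. x (k - 1)", OF B zero_less_Suc]
    moreover have R: "0 < ?m" by simp
    ultimately show ?thesis
      unfolding L emeasure_mu_tcyl[OF B R] by simp
  qed
  finally show "emeasure mu (cyl UNIV UNIV {- int ?m..int ?m} {- int ?m<..<int ?m} x B) =
      emeasure (distr mu path_space (time_shift 1)) (cyl UNIV UNIV {- int ?m..int ?m} {- int ?m<..<int ?m} x B)" ..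
next
  have "k \<in> {- int (nat \<bar>k\<bar> + 2)..int (nat \<bar>k\<bar> + 2)} \<and> k \<in> {- int (nat \<bar>k\<bar> + 2)<..<int (nat \<bar>k\<bar> + 2)}" for k
    by auto
  then show "(\<Union>n. {- int (n + 2)..int (n + 2)}) = UNIV" "(\<Union>n. {- int (n + 2)<..<int (n + 2)}) = UNIV"
    by blast+
  show "emeasure mu (cyl UNIV UNIV {- int (0 + 2)..int (0 + 2)} {- int (0 + 2)<..<int (0 + 2)} x (\<lambda>_. UNIV)) \<noteq> \<infinity>" for x
    by (subst emeasure_mu_tcyl) auto
qed (auto simp: sets_mu countable_vertices incseq_def)

lemma mu_shift: "distr mu path_space (time_shift m) = mu"
proof -
  have sh: "time_shift m \<in> measurable mu path_space" for m
    using measurable_shift by (simp add: measurable_cong_sets[OF sets_mu refl])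
  have comp: "distr mu path_space (time_shift (m + n)) = mu"
    if "distr mu path_space (time_shift m) = mu" "distr mu path_space (time_shift n) = mu" for m n
  proof -
    have "distr (distr mu path_space (time_shift n)) path_space (time_shift m) = distr mu path_space (time_shift m \<circ> time_shift n)"
      by (rule distr_distr[OF measurable_shift sh])
    then show ?thesis using that by (simp add: comp_def)
  qed
  have id': "distr mu path_space (\<lambda>h. h) = mu" by (rule distr_id2[OF sets_mu[symmetric]])
  have id: "distr mu path_space (time_shift 0) = mu"
  proof -
    have "time_shift 0 = (\<lambda>h. h)" by (rule ext) simp
    then show ?thesis using id' by simp
  qed
  have neg: "distr mu path_space (time_shift (- 1)) = mu"
  proof -
    have "distr (distr mu path_space (time_shift 1)) path_space (time_shift (- 1)) = distr mu path_space (time_shift (- 1) \<circ> time_shift 1)"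
      by (rule distr_distr[OF measurable_shift sh])
    then show ?thesis using id' by (simp add: comp_def mu_shift_1)
  qed
  show ?thesis
  proof (induction m rule: int_induct[of _ 0])
    case (step1 i) then show ?case using comp[of i 1] mu_shift_1 by simp
  next
    case (step2 i) then show ?case using comp[of i "- 1"] neg by simp
  qed (rule id)
qed

section \<open>Paths cut at their first entrance into a finite set\<close>

lemma hatW_space_sets_iff:
  "A \<in> sets (hatW_space E I) \<longleftrightarrow> A \<subseteq> hatW E I \<and> A \<in> sets (prod_space I I)"
  unfolding hatW_space_def using hatW_sets[of I]
  by (subst sets_restrict_space_iff) (auto simp: Int_absorb2 sets.sets_into_space)

lemma hatW_in_space: "h \<in> hatW E I \<Longrightarrow> h \<in> space (prod_space I I)"
  by (simp add: hatW_alt)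

definition mu_hat :: "'v path measure" where "mu_hat = restrict_space mu (hatW E UNIV)"

definition entry :: "'v set \<Rightarrow> 'v path set" where
  "entry K = {h \<in> hatW E UNIV. fst h 0 \<in> K \<and> (\<forall>k<0. fst h k \<notin> K)}"

lemma hatW_mu: "hatW E UNIV \<inter> space mu \<in> sets mu"
  using hatW_sets[of UNIV] sets.sets_into_space[OF hatW_sets[of UNIV]]
  by (simp add: sets_mu space_mu Int_absorb2)

lemma sets_mu_hat: "sets mu_hat = sets (hatW_space E UNIV)"
  unfolding mu_hat_def hatW_space_def by (rule sets_restrict_space_cong[OF sets_mu])

lemma space_mu_hat: "space mu_hat = hatW E UNIV"
  using sets_eq_imp_space_eq[OF sets_mu_hat] by simp

lemma emeasure_mu_hat: "A \<in> sets (hatW_space E UNIV) \<Longrightarrow> emeasure mu_hat A = emeasure mu A"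
  unfolding mu_hat_def by (rule emeasure_restrict_space[OF hatW_mu]) (simp add: hatW_space_sets_iff)

lemma first_entry_sets: "{h \<in> space path_space. fst h 0 \<in> K \<and> (\<forall>k<0. fst h k \<notin> K)} \<in> sets path_space"
proof (intro sets.sets_Collect_conj sets.sets_Collect_countable_All)
  show "{h \<in> space path_space. fst h 0 \<in> K} \<in> sets path_space" by (rule measurable_vertex_cylinder) simp
  have "{h \<in> space path_space. k < 0 \<longrightarrow> fst h k \<notin> K} \<in> sets path_space" for k
    by (rule measurable_vertex_cylinder[of k UNIV UNIV "\<lambda>x. k < 0 \<longrightarrow> x \<notin> K"]) simp
  then show "{h \<in> space path_space. k < 0 \<longrightarrow> fst h k \<notin> K} \<in> sets path_space" for k .
qed

lemma entry_sets: "entry K \<in> sets (hatW_space E UNIV)"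
proof -
  have "entry K = hatW E UNIV \<inter> {h \<in> space path_space. fst h 0 \<in> K \<and> (\<forall>k<0. fst h k \<notin> K)}"
    by (auto simp: entry_def hatW_in_space)
  then show ?thesis
    using hatW_sets first_entry_sets by (auto simp: hatW_space_sets_iff)
qed

definition entrance_measure :: "'v set \<Rightarrow> 'v path measure" where "entrance_measure K = density mu_hat (indicator (entry K))"

lemma sets_entrance_measure: "sets (entrance_measure K) = sets (hatW_space E UNIV)"
  by (simp add: entrance_measure_def sets_mu_hat)

lemma space_entrance_measure: "space (entrance_measure K) = hatW E UNIV"
  by (simp add: entrance_measure_def space_mu_hat)

lemma emeasure_entrance_measure: "A \<in> sets (hatW_space E UNIV) \<Longrightarrow> emeasure (entrance_measure K) A = emeasure mu_hat (entry K \<inter> A)"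
  unfolding entrance_measure_def by (rule emeasure_restricted) (simp_all add: sets_mu_hat entry_sets)

lemma entrance_measure_finite:
  assumes "finite K" shows "emeasure (entrance_measure K) (hatW E UNIV) < \<infinity>"
proof -
  have top: "hatW E UNIV \<in> sets (hatW_space E UNIV)" using sets.top[of "hatW_space E UNIV"] by simp
  let ?A = "{h \<in> space path_space. fst h 0 \<in> K}"
  have A: "?A \<in> sets path_space" by (rule measurable_vertex_cylinder) simp
  have "emeasure (entrance_measure K) (hatW E UNIV) = emeasure mu (entry K \<inter> hatW E UNIV)"
    using top entry_sets[of K] by (simp add: emeasure_entrance_measure emeasure_mu_hat)
  also have "\<dots> \<le> emeasure mu ?A"
    using A by (intro emeasure_mono) (auto simp: entry_def hatW_in_space sets_mu)
  also have "\<dots> = (\<integral>\<^sup>+z. ennreal (c z) * emeasure (two_sided z) ?A \<partial>count_space UNIV)"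
    by (rule emeasure_mu[OF A])
  also have "\<dots> = (\<Sum>z\<in>K. ennreal (c z) * emeasure (two_sided z) ?A)"
    using assms by (intro nn_integral_count_space') (auto intro!: emeasure_two_sided_null[OF A])
  also have "\<dots> < \<infinity>"
    using assms prob_space.emeasure_le_1[OF prob_space_two_sided]
    by (auto simp: ennreal_mult_less_top intro: le_less_trans[OF _ ennreal_one_less_top])
  finally show ?thesis .
qed

lemma measurable_past: "past \<in> measurable path_space (prod_space {1..} {1..})"
proof (rule measurable_into_prod_space)
  show "past \<in> space path_space \<rightarrow> space (prod_space {1..} {1..})"
    by (auto simp: past_def space_path_space space_prod_space Pi_iff)
qed (auto simp: past_def case_prod_unfold intro!: measurable_vertex measurable_time)

lemma measurable_future: "{1..} \<subseteq> I \<Longrightarrow> future \<in> measurable (prod_space I I) (prod_space {1..} {1..} :: 'v path measure)"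
  unfolding future_def by (rule measurable_restrict_path)

lemma measurable_future_one_sided: "future \<in> measurable (prod_space {0..} {0..}) (prod_space {1..} {1..} :: 'v path measure)"
  by (rule measurable_future) auto

lemma past_apply: "k \<in> {1..} \<Longrightarrow> fst (past h) k = fst h (- k)" "k \<in> {1..} \<Longrightarrow> snd (past h) k = snd h (- k)"
  by (simp_all add: past_def case_prod_unfold)

lemma future_apply: "k \<in> {1..} \<Longrightarrow> fst (future h) k = fst h k" "k \<in> {1..} \<Longrightarrow> snd (future h) k = snd h k"
  by (simp_all add: future_def restrict_path_def case_prod_unfold)

lemma past_glue: "past (glue (g, h)) = future g"
  by (auto simp: past_def future_def restrict_path_def glue_def case_prod_unfold intro!: restrict_ext)

lemma future_glue: "future (glue (g, h)) = future h"
  by (auto simp: future_def restrict_path_def glue_def case_prod_unfold intro!: restrict_ext)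

text \<open>The edge and finiteness conditions of the two halves add up to those of the two-sided path; the
edge at time \<open>- 1\<close> needs that both halves start at the same vertex.\<close>

lemma glue_hatW:
  assumes gh: "g \<in> \<Omega>" "h \<in> \<Omega>" "fst g 0 = fst h 0"
  shows "glue (g, h) \<in> hatW E UNIV \<longleftrightarrow> g \<in> hatW E {0..} \<and> h \<in> hatW E {0..}"
proof -
  let ?w = "fst (glue (g, h))"
  have sp: "glue (g, h) \<in> space path_space"
    using measurable_space[OF measurable_glue, of "(g, h)"] gh
    by (simp add: space_pair_measure space_law)
  have w: "?w k = (if 0 \<le> k then fst h k else fst g (- k))" for k by (simp add: glue_def)
  have wn: "?w (- k) = fst g k" if "0 \<le> k" for k using that gh by (simp add: w)
  have wp: "?w k = fst h k" if "0 \<le> k" for k using that by (simp add: w)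
  have ed: "(\<forall>k. {?w k, ?w (k + 1)} \<in> E) \<longleftrightarrow>
      (\<forall>k\<ge>0. {fst g k, fst g (k + 1)} \<in> E) \<and> (\<forall>k\<ge>0. {fst h k, fst h (k + 1)} \<in> E)" (is "?L \<longleftrightarrow> ?R")
  proof
    assume L: ?L
    have "{fst g k, fst g (k + 1)} \<in> E" if "0 \<le> k" for k
      using L[rule_format, of "- (k + 1)"] wn[of k] wn[of "k + 1"] that by (simp add: insert_commute)
    moreover have "{fst h k, fst h (k + 1)} \<in> E" if "0 \<le> k" for k
      using L[rule_format, of k] wp[of k] wp[of "k + 1"] that by simp
    ultimately show ?R by blast
  next
    assume R: ?R
    show ?L
    proof
      fix k
      show "{?w k, ?w (k + 1)} \<in> E"
      proof (cases "0 \<le> k")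
        case True then show ?thesis using R wp[of k] wp[of "k + 1"] by simp
      next
        case False
        then show ?thesis
          using R[THEN conjunct1, rule_format, of "- (k + 1)"] wn[of "- k"] wn[of "- (k + 1)"]
          by (simp add: insert_commute add.commute[of 1 k])
      qed
    qed
  qed
  have fin: "finite {k. ?w k = j} \<longleftrightarrow> finite {k \<in> {0..}. fst g k = j} \<and> finite {k \<in> {0..}. fst h k = j}" for j
  proof
    assume f: "finite {k. ?w k = j}"
    have "{k \<in> {0..}. fst g k = j} \<subseteq> uminus ` {k. ?w k = j}"
      using wn by (auto intro!: image_eqI[of _ _ "- _"])
    moreover have "{k \<in> {0..}. fst h k = j} \<subseteq> {k. ?w k = j}" using wp by auto
    ultimately show "finite {k \<in> {0..}. fst g k = j} \<and> finite {k \<in> {0..}. fst h k = j}"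
      using f finite_subset finite_surj by blast
  next
    assume f: "finite {k \<in> {0..}. fst g k = j} \<and> finite {k \<in> {0..}. fst h k = j}"
    have "{k. ?w k = j} \<subseteq> uminus ` {k \<in> {0..}. fst g k = j} \<union> {k \<in> {0..}. fst h k = j}"
    proof
      fix k assume k: "k \<in> {k. ?w k = j}"
      show "k \<in> uminus ` {k \<in> {0..}. fst g k = j} \<union> {k \<in> {0..}. fst h k = j}"
      proof (cases "0 \<le> k")
        case True then show ?thesis using k w by simp
      next
        case False
        then have "- k \<in> {k \<in> {0..}. fst g k = j}" using k w[of k] by simp
        then show ?thesis by (intro UnI1 image_eqI[of k uminus "- k"]) simp_all
      qed
    qed
    then show "finite {k. ?w k = j}" by (rule finite_subset) (use f in simp)
  qed
  show ?thesis using gh sp by (auto simp: hatW_alt ed fin)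
qed

text \<open>Renumbering from \<open>{0..}\<close> to \<open>{1..}\<close>; it recovers the future of a path from its shift, so that
the independence of the first holding time and the shifted path applies to futures.\<close>

definition unshift :: "'v path \<Rightarrow> 'v path" where
  "unshift h = (\<lambda>k\<in>{1..}. fst h (k - 1), \<lambda>k\<in>{1..}. snd h (k - 1))"

lemma unshift_oshift: "unshift (oshift h) = future h"
  by (auto simp: unshift_def oshift_def future_def restrict_path_def case_prod_unfold intro!: restrict_ext)

lemma measurable_unshift: "unshift \<in> measurable (prod_space {0..} {0..}) (prod_space {1..} {1..})"
proof (rule measurable_into_prod_space)
  show "unshift \<in> \<Omega> \<rightarrow> space (prod_space {1..} {1..})"
    by (auto simp: unshift_def space_prod_space PiE_def Pi_iff)
qed (auto simp: unshift_def intro!: measurable_vertex measurable_time)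

lemma hatW_future:
  assumes h: "h \<in> \<Omega>" and f: "future h \<in> hatW E {1..}"
  shows "h \<in> hatW E {0..} \<longleftrightarrow> {fst h 0, fst h 1} \<in> E"
proof
  assume e: "{fst h 0, fst h 1} \<in> E"
  have "{fst h k, fst h (k + 1)} \<in> E" if "0 \<le> k" for k
  proof (cases "k = 0")
    case False
    then have "k \<in> {1..}" "k + 1 \<in> {1..}" using that by auto
    then show ?thesis using f by (auto simp: hatW_alt future_apply)
  qed (use e in simp)
  moreover have "finite {k \<in> {0..}. fst h k = j}" for j
  proof (rule finite_subset)
    have "k \<in> insert 0 {k \<in> {1..}. fst (future h) k = j}" if "k \<in> {k \<in> {0..}. fst h k = j}" for k
      using that by (cases "k = 0") (simp_all add: future_apply)
    then show "{k \<in> {0..}. fst h k = j} \<subseteq> insert 0 {k \<in> {1..}. fst (future h) k = j}" by blast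
    show "finite (insert 0 {k \<in> {1..}. fst (future h) k = j})"
      using f by (simp add: hatW_alt)
  qed
  ultimately show "h \<in> hatW E {0..}" using h by (simp add: hatW_alt)
qed (auto simp: hatW_alt dest: spec[of _ "0::int"])

text \<open>Apart from the edge between times 0 and 1, membership of \<open>hatW\<close> is a condition on the future.
Since \<open>w(0) = x\<close> almost surely, the whole event is one on the shifted path together with the first
holding time, which is independent of it.\<close>

lemma future_holding_time:
  assumes B: "B2 \<in> sets (hatW_space E {1..})" and D: "D \<in> sets borel"
  shows "emeasure (law x) {h \<in> hatW E {0..}. snd h 0 \<in> D \<and> future h \<in> B2} =
    ennreal (measure (expo x) D) * emeasure (law x) {h \<in> hatW E {0..}. future h \<in> B2}"
proof -
  define A where "A = {g \<in> \<Omega>. unshift g \<in> B2 \<and> {x, fst g 0} \<in> E}"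
  have A: "A \<in> sets (prod_space {0..} {0..})"
    unfolding A_def
  proof (rule sets.sets_Collect_conj)
    show "{g \<in> \<Omega>. unshift g \<in> B2} \<in> sets (prod_space {0..} {0..})"
      using measurable_sets[OF measurable_unshift] B
      by (simp add: hatW_space_sets_iff vimage_def Int_def conj_commute)
    show "{g \<in> \<Omega>. {x, fst g 0} \<in> E} \<in> sets (prod_space {0..} {0..})"
      by (rule measurable_vertex_cylinder) simp
  qed
  have sub: "B2 \<subseteq> hatW E {1..}" using B by (simp add: hatW_space_sets_iff)
  have eq: "emeasure (law x) {h \<in> hatW E {0..}. snd h 0 \<in> D' \<and> future h \<in> B2} =
      emeasure (law x) {h \<in> \<Omega>. snd h 0 \<in> D' \<and> oshift h \<in> A}" if D': "D' \<in> sets borel" for D'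
  proof (rule emeasure_eq_AE)
    show "AE h in law x. (h \<in> {h \<in> hatW E {0..}. snd h 0 \<in> D' \<and> future h \<in> B2}) =
        (h \<in> {h \<in> \<Omega>. snd h 0 \<in> D' \<and> oshift h \<in> A})"
      using law_start[of x] AE_space[of "law x"]
    proof eventually_elim
      case (elim h)
      then have h: "h \<in> \<Omega>" by (simp add: space_law)
      show ?case
        using hatW_future[OF h] sub elim h
        by (auto simp: A_def unshift_oshift oshift_space oshift_apply)
    qed
    have T: "{h \<in> \<Omega>. snd h 0 \<in> D'} \<in> sets (prod_space {0..} {0..})"
      using measurable_sets[OF measurable_time[of 0 "{0..}" "{0..}"] D']
      by (simp add: vimage_def Int_def conj_commute)
    have F: "{h \<in> \<Omega>. future h \<in> B2} \<in> sets (prod_space {0..} {0..})"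
      using measurable_sets[OF measurable_future_one_sided] B
      by (simp add: hatW_space_sets_iff vimage_def Int_def conj_commute)
    have "{h \<in> hatW E {0..}. snd h 0 \<in> D' \<and> future h \<in> B2} =
        hatW E {0..} \<inter> ({h \<in> \<Omega>. snd h 0 \<in> D'} \<inter> {h \<in> \<Omega>. future h \<in> B2})"
      by (auto simp: hatW_in_space)
    then show "{h \<in> hatW E {0..}. snd h 0 \<in> D' \<and> future h \<in> B2} \<in> sets (law x)"
      unfolding sets_law using T F hatW_sets by auto
    have S: "{h \<in> \<Omega>. oshift h \<in> A} \<in> sets (prod_space {0..} {0..})"
      using measurable_sets[OF measurable_oshift A] by (simp add: vimage_def Int_def conj_commute)
    show "{h \<in> \<Omega>. snd h 0 \<in> D' \<and> oshift h \<in> A} \<in> sets (law x)"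
      unfolding sets_law using S T by (rule sets.sets_Collect_conj)
  qed
  show ?thesis
    using eq[OF D] eq[OF borel_UNIV] holding_time_independent[OF D A] by simp
qed

lemma event_sets:
  assumes B1: "B1 \<in> sets (hatW_space E {1..})" and B2: "B2 \<in> sets (hatW_space E {1..})"
  shows "{h \<in> hatW E UNIV. past h \<in> B1 \<and> fst h 0 = x \<and> a \<le> snd h 0 \<and> future h \<in> B2}
    \<in> sets (hatW_space E UNIV)"
proof -
  have "{h \<in> space path_space. past h \<in> B1} \<in> sets path_space"
    using measurable_sets[OF measurable_past] B1
    by (simp add: hatW_space_sets_iff vimage_def Int_def conj_commute)
  moreover have "{h \<in> space path_space. future h \<in> B2} \<in> sets path_space"
    using measurable_sets[OF measurable_future[of UNIV]] B2
    by (simp add: hatW_space_sets_iff vimage_def Int_def conj_commute)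
  moreover have "{h \<in> space path_space. fst h 0 = x} \<in> sets path_space" by (rule measurable_vertex_cylinder) simp
  moreover have "{h \<in> space path_space. a \<le> snd h 0} \<in> sets path_space"
    using measurable_time[of 0 UNIV UNIV] by measurable
  moreover have "{h \<in> hatW E UNIV. past h \<in> B1 \<and> fst h 0 = x \<and> a \<le> snd h 0 \<and> future h \<in> B2} = hatW E UNIV \<inter> ({h \<in> space path_space. past h \<in> B1} \<inter> ({h \<in> space path_space. fst h 0 = x} \<inter>
      ({h \<in> space path_space. a \<le> snd h 0} \<inter> {h \<in> space path_space. future h \<in> B2})))"
    by (auto simp: hatW_in_space)
  ultimately show ?thesis using hatW_sets by (auto simp: hatW_space_sets_iff)
qed

text \<open>Under gluing, avoiding \<open>K\<close> at negative times is an escape of the backward half. The event is then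
a product of a backward and a forward event, from which the holding time at time 0 splits off.\<close>

lemma emeasure_entrance_measure_event:
  assumes a: "0 \<le> a" and B1: "B1 \<in> sets (hatW_space E {1..})" and B2: "B2 \<in> sets (hatW_space E {1..})"
  shows "emeasure (entrance_measure K) {h \<in> hatW E UNIV. past h \<in> B1 \<and> fst h 0 = x \<and> a \<le> snd h 0 \<and> future h \<in> B2} =
    ennreal (c x * exp (- a * \<beta> x)) *
    emeasure (law x) {h \<in> hatW E {0..}. future h \<in> B1 \<and> h \<in> escape_set E K} *
    emeasure (law x) {h \<in> hatW E {0..}. future h \<in> B2}"
proof -
  let ?D = "{h \<in> hatW E UNIV. past h \<in> B1 \<and> fst h 0 = x \<and> a \<le> snd h 0 \<and> future h \<in> B2}"
  let ?Y1 = "{h \<in> hatW E {0..}. future h \<in> B1 \<and> h \<in> escape_set E K}"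
  let ?Y2 = "{h \<in> hatW E {0..}. snd h 0 \<in> {a..} \<and> future h \<in> B2}"
  have F: "{h \<in> \<Omega>. future h \<in> B} \<in> sets (prod_space {0..} {0..})"
    if "B \<in> sets (hatW_space E {1..})" for B
    using measurable_sets[OF measurable_future_one_sided] that
    by (simp add: hatW_space_sets_iff vimage_def Int_def conj_commute)
  have D: "?D \<in> sets (hatW_space E UNIV)" by (rule event_sets[OF B1 B2])
  have ED: "entry K \<inter> ?D \<in> sets path_space"
    using sets.Int[OF entry_sets[of K] D] by (simp add: hatW_space_sets_iff)
  have Y1: "?Y1 \<in> sets (law x)"
  proof -
    have "?Y1 = escape_set E K \<inter> {h \<in> \<Omega>. future h \<in> B1}"
      by (auto simp: escape_set_alt hatW_in_space)
    then show ?thesis unfolding sets_law using escape_set_sets F[OF B1] by auto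
  qed
  have Y2: "?Y2 \<in> sets (law x)"
  proof -
    have "{h \<in> \<Omega>. a \<le> snd h 0} \<in> sets (prod_space {0..} {0..})"
      using measurable_time[of 0 "{0..}" "{0..}"] by measurable
    moreover have "?Y2 = hatW E {0..} \<inter> ({h \<in> \<Omega>. a \<le> snd h 0} \<inter> {h \<in> \<Omega>. future h \<in> B2})"
      by (auto simp: hatW_in_space)
    ultimately show ?thesis unfolding sets_law using F[OF B2] hatW_sets by auto
  qed
  have "emeasure (entrance_measure K) ?D = emeasure mu (entry K \<inter> ?D)"
    using D entry_sets[of K] by (simp add: emeasure_entrance_measure emeasure_mu_hat)
  also have "\<dots> = ennreal (c x) * emeasure (two_sided x) (entry K \<inter> ?D)"
    by (rule emeasure_mu_from[OF ED emeasure_two_sided_null[OF ED]]) auto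
  also have "emeasure (two_sided x) (entry K \<inter> ?D) = emeasure (law x) ?Y1 * emeasure (law x) ?Y2"
  proof (rule emeasure_two_sided[OF ED Y1 Y2])
    fix g h assume gh: "g \<in> \<Omega>" "h \<in> \<Omega>" "fst g 0 = x" "fst h 0 = x"
    have esc: "(\<forall>k<0. fst (glue (g, h)) k \<notin> K) \<longleftrightarrow> (\<forall>k>0. fst g k \<notin> K)"
    proof
      assume L: "\<forall>k<0. fst (glue (g, h)) k \<notin> K"
      show "\<forall>k>0. fst g k \<notin> K"
      proof (intro allI impI)
        fix k :: int assume "0 < k"
        then show "fst g k \<notin> K" using L[rule_format, of "- k"] by (simp add: glue_apply)
      qed
    qed (simp add: glue_apply)
    have 0: "fst (glue (g, h)) 0 = x" "snd (glue (g, h)) 0 = snd h 0"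
      using gh by (simp_all add: glue_apply)
    have "glue (g, h) \<in> hatW E UNIV \<longleftrightarrow> g \<in> hatW E {0..} \<and> h \<in> hatW E {0..}"
      using glue_hatW[of g h] gh by simp
    then show "glue (g, h) \<in> entry K \<inter> ?D \<longleftrightarrow> g \<in> ?Y1 \<and> h \<in> ?Y2"
      using gh by (auto simp: entry_def escape_set_alt past_glue future_glue 0 esc)
  qed
  also have "emeasure (law x) ?Y2 =
      ennreal (exp (- a * \<beta> x)) * emeasure (law x) {h \<in> hatW E {0..}. future h \<in> B2}"
    using future_holding_time[OF B2, of "{a..}" x] expo_at_least[OF a, of x] by simp
  finally show ?thesis
    using c_pos[of x] by (simp add: ennreal_mult ac_simps)
qed

lemma measure_hat_jump_law:
  "measure (hat_jump_law E C u \<beta> x) {h \<in> space (hat_jump_law E C u \<beta> x). P h} =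
    measure (law x) {h \<in> hatW E {0..}. P h}"
proof -
  have H: "hatW E {0..} \<inter> space (law x) = hatW E {0..}"
    using sets.sets_into_space[OF hatW_sets[of "{0..}"]] by (simp add: space_law Int_absorb2)
  show ?thesis
    unfolding hat_jump_law_def jump_law_eq_law space_restrict_space H
    by (rule measure_restrict_space) (auto simp: H sets_law hatW_sets)
qed

lemma is_hatQ_entrance_measure:
  assumes "finite K" shows "is_hatQ E C u \<beta> K (entrance_measure K)"
proof -
  interpret Q: finite_measure "entrance_measure K"
    using entrance_measure_finite[OF assms] by (intro finite_measureI) (simp add: space_entrance_measure)
  show ?thesis
    unfolding is_hatQ_def
  proof (intro conjI allI impI ballI)
    show "finite_measure (entrance_measure K)" "sets (entrance_measure K) = sets (hatW_space E UNIV)"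
      by (rule Q.finite_measure_axioms sets_entrance_measure)+
    fix x :: 'v and a :: real and B1 B2 :: "'v path set"
    assume a: "0 \<le> a" and B: "B1 \<in> sets (hatW_space E {1..})" "B2 \<in> sets (hatW_space E {1..})"
    interpret L: prob_space "law x" by (rule prob_space_law)
    have "ennreal (measure (entrance_measure K) {h \<in> hatW E UNIV. past h \<in> B1 \<and> fst h 0 = x \<and> a \<le> snd h 0 \<and> future h \<in> B2}) =
      ennreal (c x * exp (- a * \<beta> x) *
      measure (law x) {h \<in> hatW E {0..}. future h \<in> B1 \<and> h \<in> escape_set E K} *
      measure (law x) {h \<in> hatW E {0..}. future h \<in> B2})"
      using emeasure_entrance_measure_event[OF a B, of K x] c_pos[of x]
      by (simp add: Q.emeasure_eq_measure L.emeasure_eq_measure ennreal_mult)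
    then have "measure (entrance_measure K) {h \<in> hatW E UNIV. past h \<in> B1 \<and> fst h 0 = x \<and> a \<le> snd h 0 \<and> future h \<in> B2} =
      c x * exp (- a * \<beta> x) *
      measure (law x) {h \<in> hatW E {0..}. future h \<in> B1 \<and> h \<in> escape_set E K} *
      measure (law x) {h \<in> hatW E {0..}. future h \<in> B2}"
      using c_pos[of x] by (subst (asm) ennreal_inj) auto
    then show "measure (entrance_measure K) {(w, l) \<in> space (entrance_measure K). past (w, l) \<in> B1 \<and> w 0 = x \<and> a \<le> l 0 \<and> future (w, l) \<in> B2} =
        \<beta> x * exp (- a * \<beta> x) * exp (2 * u x)
        * measure (hat_jump_law E C u \<beta> x)
            {h \<in> space (hat_jump_law E C u \<beta> x). future h \<in> B1 \<and> h \<in> escape_set E K}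
        * measure (hat_jump_law E C u \<beta> x)
            {h \<in> space (hat_jump_law E C u \<beta> x). future h \<in> B2}"
      unfolding measure_hat_jump_law by (simp add: c_def space_entrance_measure case_prod_unfold mult.assoc mult.commute[of "exp (2 * u x)"])
  qed
qed

text \<open>The events in the defining formula form a \<open>\<pi>\<close>-system, since different values of \<open>w(0)\<close> exclude
each other and half-lines are nested. They generate the \<open>\<sigma>\<close>-algebra: a path is measurable in
terms of its past, its state and holding time at time 0, and its future.\<close>

lemma is_hatQ_unique:
  assumes M: "is_hatQ E C u \<beta> K M" and N: "is_hatQ E C u \<beta> K N"
  shows "M = N"
proof -
  define ev where "ev x a B1 B2 =
    {h \<in> hatW E UNIV. past h \<in> B1 \<and> fst h 0 = x \<and> a \<le> snd h 0 \<and> future h \<in> B2}" for x a B1 B2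
  let ?S = "sets (hatW_space E {1..})"
  define \<G> where "\<G> = insert {} {ev x a B1 B2 | x a B1 B2. 0 \<le> a \<and> B1 \<in> ?S \<and> B2 \<in> ?S}"
  have sM: "sets M = sets (hatW_space E UNIV)" and sN: "sets N = sets (hatW_space E UNIV)"
    using M N by (auto simp: is_hatQ_def)
  interpret M: finite_measure M using M by (simp add: is_hatQ_def)
  interpret N: finite_measure N using N by (simp add: is_hatQ_def)
  have sp: "space M = hatW E UNIV" "space N = hatW E UNIV"
    using sets_eq_imp_space_eq[OF sM] sets_eq_imp_space_eq[OF sN] by simp_all
  have eq: "emeasure M X = emeasure N X" if "X \<in> \<G>" for X
  proof (cases "X = {}")
    case False
    then obtain x a B1 B2 where X: "X = ev x a B1 B2" and "0 \<le> a" "B1 \<in> ?S" "B2 \<in> ?S"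
      using \<open>X \<in> \<G>\<close> unfolding \<G>_def by blast
    then have "measure M X = measure N X"
      using M N unfolding is_hatQ_def by (simp add: sp ev_def case_prod_unfold)
    then show ?thesis by (simp add: M.emeasure_eq_measure N.emeasure_eq_measure)
  qed simp
  have H1: "hatW E {1..} \<in> ?S" using sets.top[of "hatW_space E {1..}"] by simp
  have pf: "past h \<in> hatW E {1..}" "future h \<in> hatW E {1..}" if h: "h \<in> hatW E UNIV" for h
  proof -
    have f: "finite {k. fst h k = j}" for j using h by (simp add: hatW_alt)
    have e: "{fst h k, fst h (k + 1)} \<in> E" for k using h by (simp add: hatW_alt)
    have "k \<in> uminus ` {k. fst h k = j}" if "k \<in> {k \<in> {1..}. fst (past h) k = j}" for j k
      using that by (intro image_eqI[of _ _ "- k"]) (auto simp: past_apply)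
    then have "{k \<in> {1..}. fst (past h) k = j} \<subseteq> uminus ` {k. fst h k = j}" for j
      by blast
    then have "finite {k \<in> {1..}. fst (past h) k = j}" for j by (rule finite_surj[OF f])
    moreover have "{fst (past h) k, fst (past h) (k + 1)} \<in> E" if "k \<in> {1..}" for k
      using that e[of "- (k + 1)"] by (simp add: past_apply insert_commute)
    ultimately show "past h \<in> hatW E {1..}"
      using measurable_space[OF measurable_past hatW_in_space[OF h]] by (simp add: hatW_alt)
    have "{k \<in> {1..}. fst (future h) k = j} \<subseteq> {k. fst h k = j}" for j
      by (auto simp: future_apply)
    then have "finite {k \<in> {1..}. fst (future h) k = j}" for j by (rule finite_subset[OF _ f])
    moreover have "{fst (future h) k, fst (future h) (k + 1)} \<in> E" if "k \<in> {1..}" for k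
      using that e[of k] by (simp add: future_apply)
    ultimately show "future h \<in> hatW E {1..}"
      using measurable_space[OF measurable_future[of UNIV] hatW_in_space[OF h]] by (simp add: hatW_alt)
  qed
  have pos: "0 < snd h 0" if "h \<in> hatW E UNIV" for h
    using hatW_in_space[OF that] by (auto simp: space_path_space)
  have ev_top: "ev x 0 (hatW E {1..}) (hatW E {1..}) = {h \<in> hatW E UNIV. fst h 0 = x}" for x
    unfolding ev_def using pf less_imp_le[OF pos] by blast
  have \<G>sub: "\<G> \<subseteq> Pow (hatW E UNIV)" by (auto simp: \<G>_def ev_def)
  have Int: "Int_stable \<G>"
  proof (rule Int_stableI)
    fix X Y assume "X \<in> \<G>" "Y \<in> \<G>"
    show "X \<inter> Y \<in> \<G>"
    proof (cases "X \<inter> Y = {}")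
      case False
      then obtain x a B1 B2 y b D1 D2 where
        X: "X = ev x a B1 B2" "0 \<le> a" "B1 \<in> ?S" "B2 \<in> ?S" and
        Y: "Y = ev y b D1 D2" "0 \<le> b" "D1 \<in> ?S" "D2 \<in> ?S"
        using \<open>X \<in> \<G>\<close> \<open>Y \<in> \<G>\<close> unfolding \<G>_def by blast
      have "x = y" using False X Y by (auto simp: ev_def)
      then have "X \<inter> Y = ev x (max a b) (B1 \<inter> D1) (B2 \<inter> D2)"
        using X Y by (auto simp: ev_def)
      moreover have "0 \<le> max a b" "B1 \<inter> D1 \<in> ?S" "B2 \<inter> D2 \<in> ?S" using X Y by auto
      ultimately show ?thesis unfolding \<G>_def by blast
    qed (simp add: \<G>_def)
  qed
  let ?\<Sigma> = "sigma (hatW E UNIV) \<G>"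
  have spS: "space ?\<Sigma> = hatW E UNIV" and seS: "sets ?\<Sigma> = sigma_sets (hatW E UNIV) \<G>"
    using \<G>sub by (simp_all add: space_measure_of sets_measure_of)
  have ev: "ev x a B1 B2 \<in> sets ?\<Sigma>" if "0 \<le> a" "B1 \<in> ?S" "B2 \<in> ?S" for x a B1 B2
    unfolding seS using that by (intro sigma_sets.Basic) (auto simp: \<G>_def)
  have ev_all: "{h \<in> hatW E UNIV. past h \<in> B1 \<and> future h \<in> B2} \<in> sets ?\<Sigma>" if "B1 \<in> ?S" "B2 \<in> ?S" for B1 B2
  proof -
    have "{h \<in> hatW E UNIV. past h \<in> B1 \<and> future h \<in> B2} = (\<Union>x\<in>UNIV. ev x 0 B1 B2)"
      unfolding ev_def using less_imp_le[OF pos] by blast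
    also have "\<dots> \<in> sets ?\<Sigma>" using that ev by (intro sets.countable_UN'' countable_vertices) auto
    finally show ?thesis .
  qed
  have pastm: "{h \<in> hatW E UNIV. past h \<in> B} \<in> sets ?\<Sigma>"
    and futm: "{h \<in> hatW E UNIV. future h \<in> B} \<in> sets ?\<Sigma>" if "B \<in> sets (prod_space {1..} {1..})" for B
  proof -
    have i: "B \<inter> hatW E {1..} \<in> ?S" using that hatW_sets by (auto simp: hatW_space_sets_iff)
    have "{h \<in> hatW E UNIV. past h \<in> B} =
        {h \<in> hatW E UNIV. past h \<in> B \<inter> hatW E {1..} \<and> future h \<in> hatW E {1..}}"
      using pf by auto
    then show "{h \<in> hatW E UNIV. past h \<in> B} \<in> sets ?\<Sigma>" using ev_all[OF i H1] by (rule ssubst)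
    have "{h \<in> hatW E UNIV. future h \<in> B} =
        {h \<in> hatW E UNIV. past h \<in> hatW E {1..} \<and> future h \<in> B \<inter> hatW E {1..}}"
      using pf by auto
    then show "{h \<in> hatW E UNIV. future h \<in> B} \<in> sets ?\<Sigma>" using ev_all[OF H1 i] by (rule ssubst)
  qed
  have mp: "past \<in> measurable ?\<Sigma> (prod_space {1..} {1..})"
    using pastm measurable_space[OF measurable_past hatW_in_space]
    by (intro measurableI) (simp_all add: spS vimage_def Int_def conj_commute)
  have mf: "future \<in> measurable ?\<Sigma> (prod_space {1..} {1..})"
    using futm measurable_space[OF measurable_future[of UNIV] hatW_in_space]
    by (intro measurableI) (simp_all add: spS vimage_def Int_def conj_commute)
  have id: "(\<lambda>h. h) \<in> measurable ?\<Sigma> path_space"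
  proof (rule measurable_into_prod_space)
    show "(\<lambda>h. h) \<in> space ?\<Sigma> \<rightarrow> space path_space" unfolding spS by (intro Pi_I hatW_in_space)
    fix k :: int
    have k: "k = 0 \<or> k \<in> {1..} \<or> - k \<in> {1..}" by (cases k "0::int" rule: linorder_cases) simp_all
    have 0: "(\<lambda>h. fst h 0) \<in> measurable ?\<Sigma> (count_space UNIV)"
      unfolding measurable_count_space_eq_countable[OF countable_vertices]
    proof (intro conjI ballI)
      fix x
      have "(\<lambda>h. fst h 0) -` {x} \<inter> space ?\<Sigma> = ev x 0 (hatW E {1..}) (hatW E {1..})"
        by (auto simp: spS ev_top)
      then show "(\<lambda>h. fst h 0) -` {x} \<inter> space ?\<Sigma> \<in> sets ?\<Sigma>" using ev H1 by simp
    qed simp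
    have past_k: "(\<lambda>h :: 'v path. fst h k) = (\<lambda>h. fst (past h) (- k))"
        "(\<lambda>h :: 'v path. snd h k) = (\<lambda>h. snd (past h) (- k))" if "- k \<in> {1..}"
      using that by (simp_all add: past_apply)
    have fut_k: "(\<lambda>h :: 'v path. fst h k) = (\<lambda>h. fst (future h) k)"
        "(\<lambda>h :: 'v path. snd h k) = (\<lambda>h. snd (future h) k)" if "k \<in> {1..}"
      using that by (simp_all add: future_apply)
    show "(\<lambda>h. fst h k) \<in> measurable ?\<Sigma> (count_space UNIV)"
    proof -
      consider "k = 0" | "k \<in> {1..}" | "- k \<in> {1..}" using k by blast
      then show ?thesis
      proof cases
        case 2 show ?thesis by (subst fut_k(1)[OF 2]) (rule measurable_compose[OF mf measurable_vertex[OF 2]])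
      next
        case 3 show ?thesis by (subst past_k(1)[OF 3]) (rule measurable_compose[OF mp measurable_vertex[OF 3]])
      qed (simp add: 0)
    qed
    show "(\<lambda>h. snd h k) \<in> borel_measurable ?\<Sigma>"
    proof -
      consider "k = 0" | "k \<in> {1..}" | "- k \<in> {1..}" using k by blast
      then show ?thesis
      proof cases
        case 1
        show ?thesis unfolding 1 borel_measurable_iff_ge
        proof
          fix a :: real
          \<comment> \<open>holding times are positive, so half-lines starting at negative times may be cut at 0\<close>
          have "max a 0 \<le> snd h 0 \<longleftrightarrow> a \<le> snd h 0" if "h \<in> hatW E UNIV" for h
            using pos[OF that] by simp
          then have "{h \<in> space ?\<Sigma>. a \<le> snd h 0} =
              (\<Union>x\<in>UNIV. ev x (max a 0) (hatW E {1..}) (hatW E {1..}))"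
            unfolding spS ev_def using pf by blast
          also have "\<dots> \<in> sets ?\<Sigma>" using H1 ev by (intro sets.countable_UN'' countable_vertices) auto
          finally show "{h \<in> space ?\<Sigma>. a \<le> snd h 0} \<in> sets ?\<Sigma>" .
        qed
      next
        case 2 show ?thesis by (subst fut_k(2)[OF 2]) (rule measurable_compose[OF mf measurable_time[OF 2]])
      next
        case 3 show ?thesis by (subst past_k(2)[OF 3]) (rule measurable_compose[OF mp measurable_time[OF 3]])
      qed
    qed
  qed
  have evH: "ev x a B1 B2 \<in> sets (hatW_space E UNIV)" if "0 \<le> a" "B1 \<in> ?S" "B2 \<in> ?S" for x a B1 B2
    unfolding ev_def using that by (intro event_sets)
  have gen: "sets (hatW_space E UNIV) = sigma_sets (hatW E UNIV) \<G>"
  proof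
    show "sigma_sets (hatW E UNIV) \<G> \<subseteq> sets (hatW_space E UNIV)"
      using evH sets.sigma_sets_subset[of \<G> "hatW_space E UNIV"] by (auto simp: \<G>_def)
    show "sets (hatW_space E UNIV) \<subseteq> sigma_sets (hatW E UNIV) \<G>"
    proof
      fix X assume "X \<in> sets (hatW_space E UNIV)"
      then have X: "X \<in> sets path_space" "X \<inter> hatW E UNIV = X" by (auto simp: hatW_space_sets_iff)
      then show "X \<in> sigma_sets (hatW E UNIV) \<G>"
        using measurable_sets[OF id X(1)] unfolding spS seS vimage_ident by simp
    qed
  qed
  show ?thesis
  proof (rule measure_eqI_generator_eq_countable[where E = \<G> and \<Omega> = "hatW E UNIV"
        and A = "(\<lambda>x. ev x 0 (hatW E {1..}) (hatW E {1..})) ` UNIV"])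
    show "sets M = sigma_sets (hatW E UNIV) \<G>" "sets N = sigma_sets (hatW E UNIV) \<G>"
      using sM sN gen by auto
    show "(\<lambda>x. ev x 0 (hatW E {1..}) (hatW E {1..})) ` UNIV \<subseteq> \<G>"
      using H1 by (auto simp: \<G>_def)
    show "\<Union> ((\<lambda>x. ev x 0 (hatW E {1..}) (hatW E {1..})) ` UNIV) = hatW E UNIV"
      by (auto simp: ev_top)
    show "countable ((\<lambda>x. ev x 0 (hatW E {1..}) (hatW E {1..})) ` UNIV)"
      using countable_vertices by (rule countable_image)
  qed (use Int \<G>sub eq in auto)
qed

lemma hatQ_eq_entrance_measure: "finite K \<Longrightarrow> hatQ E C u \<beta> K = entrance_measure K"
  unfolding hatQ_def using is_hatQ_entrance_measure is_hatQ_unique by (intro the_equality) auto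

section \<open>Measures on paths modulo time shift\<close>

abbreviation H :: "'v path set" where "H \<equiv> hatW E UNIV"

lemma two_sided_hatW_alt: "H = {h \<in> space path_space. (\<forall>k. {fst h k, fst h (k + 1)} \<in> E) \<and> (\<forall>j. finite {k. fst h k = j})}"
  by (simp add: hatW_alt)

lemma hatW_shift: "h \<in> H \<Longrightarrow> time_shift m h \<in> H"
proof -
  assume h: "h \<in> H"
  have "finite {k. fst h (k + m) = j}" for j
  proof (rule finite_surj)
    show "finite {k. fst h k = j}" using h by (simp add: two_sided_hatW_alt)
    show "{k. fst h (k + m) = j} \<subseteq> (\<lambda>k. k - m) ` {k. fst h k = j}"
    proof
      fix k assume "k \<in> {k. fst h (k + m) = j}"
      then show "k \<in> (\<lambda>k. k - m) ` {k. fst h k = j}"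
        by (intro image_eqI[of _ _ "k + m"]) simp_all
    qed
  qed
  moreover have "{fst h (k + m), fst h (k + 1 + m)} \<in> E" for k
  proof -
    have "{fst h (k + m), fst h (k + m + 1)} \<in> E" using h by (simp add: two_sided_hatW_alt)
    then show ?thesis by (simp add: add.commute add.left_commute)
  qed
  ultimately show "time_shift m h \<in> H"
    using measurable_space[OF measurable_shift hatW_in_space[OF h]] by (simp add: two_sided_hatW_alt)
qed

lemma shift_rel_iff: "(h, h') \<in> shift_rel E \<longleftrightarrow> h \<in> H \<and> h' \<in> H \<and> (\<exists>m. h = time_shift m h')"
  by (auto simp: shift_rel_def time_shift_def prod_eq_iff fun_eq_iff case_prod_unfold)

lemma equiv_shift_rel: "equiv H (shift_rel E)"
proof (rule equivI)
  show "refl_on H (shift_rel E)"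
    by (auto simp: refl_on_def shift_rel_iff intro: exI[of _ 0])
  show "sym (shift_rel E)"
  proof (rule symI)
    fix h h' assume a: "(h, h') \<in> shift_rel E"
    then obtain m where "h = time_shift m h'" by (auto simp: shift_rel_iff)
    then have "h' = time_shift (- m) h" by simp
    then show "(h', h) \<in> shift_rel E" using a by (auto simp: shift_rel_iff)
  qed
  show "trans (shift_rel E)"
    by (rule transI) (auto simp: shift_rel_iff)
qed (auto simp: shift_rel_iff)

lemma proj_eq_iff: "h \<in> H \<Longrightarrow> h' \<in> H \<Longrightarrow> proj_star E h = proj_star E h' \<longleftrightarrow> (\<exists>m. h = time_shift m h')"
  unfolding proj_star_def using eq_equiv_class_iff[OF equiv_shift_rel, of h h'] by (simp add: shift_rel_iff)

lemma proj_shift: "h \<in> H \<Longrightarrow> proj_star E (time_shift m h) = proj_star E h"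
  using proj_eq_iff[of "time_shift m h" h] hatW_shift by auto

lemma proj_mem: "h \<in> H \<Longrightarrow> proj_star E h \<in> hatW_star E"
  by (auto simp: proj_star_def hatW_star_def intro: quotientI)

lemma hatW_star_image: "hatW_star E = proj_star E ` H"
  by (auto simp: hatW_star_def quotient_def proj_star_def)

lemma star_K_iff:
  assumes h: "h \<in> H" shows "proj_star E h \<in> hatW_star_K E K \<longleftrightarrow> (\<exists>k. fst h k \<in> K)"
proof
  assume "proj_star E h \<in> hatW_star_K E K"
  then obtain g where g: "g \<in> H" "fst g 0 \<in> K" "proj_star E h = proj_star E g"
    by (auto simp: hatW_star_K_def)
  then obtain m where "g = time_shift m h" using proj_eq_iff[of g h] h by auto
  then show "\<exists>k. fst h k \<in> K" using g by auto
next
  assume "\<exists>k. fst h k \<in> K"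
  then obtain k where "fst (time_shift k h) 0 \<in> K" by auto
  then have "proj_star E (time_shift k h) \<in> hatW_star_K E K"
    using hatW_shift[OF h, of k] by (auto simp: hatW_star_K_def case_prod_unfold)
  then show "proj_star E h \<in> hatW_star_K E K" by (simp add: proj_shift h)
qed

definition star_preimage :: "'v path set set \<Rightarrow> 'v path set" where "star_preimage A = proj_star E -` A \<inter> H"

lemma star_sets_iff: "A \<in> sets (hatW_star_space E) \<longleftrightarrow> A \<subseteq> hatW_star E \<and> star_preimage A \<in> sets (hatW_space E UNIV)"
  by (simp add: sets_hatW_star_space star_preimage_def)

lemma star_preimage_shift: "h \<in> H \<Longrightarrow> time_shift m h \<in> star_preimage A \<longleftrightarrow> h \<in> star_preimage A"
  by (simp add: star_preimage_def proj_shift hatW_shift)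

lemma visits_sets: "{h \<in> H. \<exists>k. fst h k \<in> K} \<in> sets (hatW_space E UNIV)"
proof -
  have "{h \<in> space path_space. fst h k \<in> K} \<in> sets path_space" for k by (rule measurable_vertex_cylinder) simp
  then have "{h \<in> space path_space. \<exists>k. fst h k \<in> K} \<in> sets path_space" by (rule sets.sets_Collect_countable_Ex)
  moreover have "{h \<in> H. \<exists>k. fst h k \<in> K} = H \<inter> {h \<in> space path_space. \<exists>k. fst h k \<in> K}"
    by (auto simp: hatW_in_space)
  ultimately show ?thesis using hatW_sets by (auto simp: hatW_space_sets_iff)
qed

lemma star_preimage_star_K: "star_preimage (hatW_star_K E K) = {h \<in> H. \<exists>k. fst h k \<in> K}"
  using star_K_iff by (auto simp: star_preimage_def)

lemma star_K_sets: "hatW_star_K E K \<in> sets (hatW_star_space E)"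
  unfolding star_sets_iff star_preimage_star_K using visits_sets
  by (auto simp: hatW_star_K_def intro: proj_mem)

lemma measurable_proj: "sets M = sets (hatW_space E UNIV) \<Longrightarrow> proj_star E \<in> measurable M (hatW_star_space E)"
proof (rule measurableI)
  assume s: "sets M = sets (hatW_space E UNIV)"
  then have sp: "space M = H" using sets_eq_imp_space_eq[OF s] by simp
  show "proj_star E h \<in> space (hatW_star_space E)" if "h \<in> space M" for h
    using that by (simp add: sp proj_mem)
  show "proj_star E -` A \<inter> space M \<in> sets M" if "A \<in> sets (hatW_star_space E)" for A
    using that by (simp add: sp s star_sets_iff star_preimage_def)
qed

lemma mu_hat_shift:
  assumes A: "A \<in> sets (hatW_space E UNIV)"
  shows "{h \<in> H. time_shift m h \<in> A} \<in> sets (hatW_space E UNIV)"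
    and "emeasure mu_hat {h \<in> H. time_shift m h \<in> A} = emeasure mu_hat A"
proof -
  have A': "A \<in> sets path_space" "A \<subseteq> H" using A by (auto simp: hatW_space_sets_iff)
  have eq: "{h \<in> H. time_shift m h \<in> A} = time_shift m -` A \<inter> space path_space"
  proof (intro set_eqI iffI)
    fix h assume h: "h \<in> time_shift m -` A \<inter> space path_space"
    then have "time_shift m h \<in> H" using A' by auto
    then have "time_shift (- m) (time_shift m h) \<in> H" by (rule hatW_shift)
    then show "h \<in> {h \<in> H. time_shift m h \<in> A}" using h by simp
  qed (auto simp: hatW_in_space)
  show s: "{h \<in> H. time_shift m h \<in> A} \<in> sets (hatW_space E UNIV)"
    using measurable_sets[OF measurable_shift A'(1), of m] unfolding hatW_space_sets_iff eq[symmetric] by auto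
  have sh: "time_shift m \<in> measurable mu path_space"
    using measurable_shift by (simp add: measurable_cong_sets[OF sets_mu refl])
  have "emeasure mu A = emeasure (distr mu path_space (time_shift m)) A" by (simp add: mu_shift)
  also have "\<dots> = emeasure mu {h \<in> H. time_shift m h \<in> A}"
    using emeasure_distr[OF sh A'(1)] by (simp add: space_mu eq)
  finally show "emeasure mu_hat {h \<in> H. time_shift m h \<in> A} = emeasure mu_hat A"
    using A s by (simp add: emeasure_mu_hat)
qed

definition hits :: "'v path set \<Rightarrow> 'v path set" where
  "hits D = {h \<in> H. \<exists>m. time_shift m h \<in> D}"

text \<open>Measurable sets that meet each shift orbit at most once. A path that visits each vertex finitely
often is not periodic, so its shifts by different times are different paths and the orbit may be
indexed by the time of the shift.\<close>

definition section_of_shift :: "'v path set \<Rightarrow> bool" where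
  "section_of_shift D \<longleftrightarrow> D \<in> sets (hatW_space E UNIV) \<and>
     (\<forall>h\<in>D. \<forall>m. time_shift m h \<in> D \<longrightarrow> m = 0)"

text \<open>Split \<open>D1 \<inter> A \<inter> hits D2\<close> by the unique \<open>m\<close> that shifts the path into \<open>D2\<close>. Shifting the \<open>m\<close>-th
part by \<open>m\<close> turns it into the part of \<open>D2 \<inter> A\<close> that is shifted by \<open>- m\<close> into \<open>D1\<close>, with the same
measure by invariance. Summation over \<open>m\<close> gives the claim.\<close>

lemma section_transfer:
  assumes D1: "section_of_shift D1" and D2: "section_of_shift D2"
    and A: "A \<in> sets (hatW_space E UNIV)" and inv: "\<And>h m. h \<in> H \<Longrightarrow> time_shift m h \<in> A \<longleftrightarrow> h \<in> A"
  shows "emeasure mu_hat (D1 \<inter> A \<inter> hits D2) = emeasure mu_hat (D2 \<inter> A \<inter> hits D1)"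
proof -
  have expand: "emeasure mu_hat (D \<inter> A \<inter> hits D') =
      (\<integral>\<^sup>+m. emeasure mu_hat {h \<in> D \<inter> A. time_shift m h \<in> D'} \<partial>count_space UNIV)"
    if D: "section_of_shift D" and D': "section_of_shift D'" for D D'
  proof -
    have s: "D \<in> sets (hatW_space E UNIV)" "D' \<in> sets (hatW_space E UNIV)"
      using D D' by (auto simp: section_of_shift_def)
    then have sub: "D \<subseteq> H" by (simp add: hatW_space_sets_iff)
    have "D \<inter> A \<inter> hits D' = (\<Union>m. {h \<in> D \<inter> A. time_shift m h \<in> D'})"
      using sub by (auto simp: hits_def)
    moreover have "{h \<in> D \<inter> A. time_shift m h \<in> D'} \<in> sets mu_hat" for m
    proof -
      have "{h \<in> D \<inter> A. time_shift m h \<in> D'} = D \<inter> A \<inter> {h \<in> H. time_shift m h \<in> D'}"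
        using sub by auto
      then show ?thesis using s A mu_hat_shift(1)[OF s(2)] by (auto simp: sets_mu_hat)
    qed
    moreover have "disjoint_family (\<lambda>m. {h \<in> D \<inter> A. time_shift m h \<in> D'})"
    proof (unfold disjoint_family_on_def, intro ballI impI, rule ccontr)
      fix m n :: int assume mn: "m \<noteq> n"
        and "{h \<in> D \<inter> A. time_shift m h \<in> D'} \<inter> {h \<in> D \<inter> A. time_shift n h \<in> D'} \<noteq> {}"
      then obtain h where h: "time_shift m h \<in> D'" "time_shift n h \<in> D'" by blast
      then have "time_shift (n - m) (time_shift m h) \<in> D'" by simp
      then have "n - m = 0" using D' h(1) unfolding section_of_shift_def by blast
      then show False using mn by simp
    qed
    ultimately show ?thesis by (simp add: emeasure_UN_countable)
  qed
  have D1s: "D1 \<in> sets (hatW_space E UNIV)" "D1 \<subseteq> H" and D2s: "D2 \<in> sets (hatW_space E UNIV)" "D2 \<subseteq> H"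
    using D1 D2 by (auto simp: section_of_shift_def hatW_space_sets_iff)
  have sym: "emeasure mu_hat {h \<in> D1 \<inter> A. time_shift m h \<in> D2} =
      emeasure mu_hat {h \<in> D2 \<inter> A. time_shift (- m) h \<in> D1}" for m
  proof -
    let ?B = "{h \<in> D2 \<inter> A. time_shift (- m) h \<in> D1}"
    have "?B = D2 \<inter> A \<inter> {h \<in> H. time_shift (- m) h \<in> D1}" using D2s by auto
    then have B: "?B \<in> sets (hatW_space E UNIV)" using D2s A mu_hat_shift(1)[OF D1s(1)] by auto
    have "{h \<in> H. time_shift m h \<in> ?B} = {h \<in> D1 \<inter> A. time_shift m h \<in> D2}"
      using D1s(2) inv by auto
    then show ?thesis using mu_hat_shift(2)[OF B, of m] by simp
  qed
  have "emeasure mu_hat (D1 \<inter> A \<inter> hits D2) =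
      (\<integral>\<^sup>+m. emeasure mu_hat {h \<in> D2 \<inter> A. time_shift (- m) h \<in> D1} \<partial>count_space UNIV)"
    unfolding expand[OF D1 D2] sym ..
  also have "\<dots> = (\<integral>\<^sup>+m. emeasure mu_hat {h \<in> D2 \<inter> A. time_shift m h \<in> D1} \<partial>count_space UNIV)"
    by (rule nn_integral_bij_count_space) (rule bij_uminus)
  finally show ?thesis unfolding expand[OF D2 D1] .
qed

lemma section_entry: "section_of_shift (entry K)"
  unfolding section_of_shift_def
proof (intro conjI ballI allI impI entry_sets)
  fix h m assume h: "h \<in> entry K" and m: "time_shift m h \<in> entry K"
  have "\<not> m < 0" using h m by (auto simp: entry_def)
  moreover have "\<not> 0 < m"
  proof
    assume "0 < m"
    moreover have "\<forall>k<0. fst (time_shift m h) k \<notin> K" using m by (simp add: entry_def)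
    ultimately have "fst (time_shift m h) (- m) \<notin> K" by (metis neg_less_0_iff_less)
    then show False using h by (simp add: entry_def)
  qed
  ultimately show "m = 0" by simp
qed

text \<open>A path visits a finite set finitely often, so there is a first visit.\<close>

lemma hits_entry:
  assumes K: "finite K" shows "hits (entry K) = {h \<in> H. \<exists>k. fst h k \<in> K}"
proof (intro set_eqI iffI)
  fix h assume "h \<in> hits (entry K)"
  then show "h \<in> {h \<in> H. \<exists>k. fst h k \<in> K}" by (auto simp: hits_def entry_def)
next
  fix h assume h: "h \<in> {h \<in> H. \<exists>k. fst h k \<in> K}"
  let ?T = "{k. fst h k \<in> K}"
  have "?T = (\<Union>j\<in>K. {k. fst h k = j})" by auto
  then have fin: "finite ?T" using K h by (simp add: two_sided_hatW_alt)
  have ne: "?T \<noteq> {}" using h by auto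
  have "fst h (k + Min ?T) \<notin> K" if "k < 0" for k
    using Min_le[OF fin, of "k + Min ?T"] that by auto
  then have "time_shift (Min ?T) h \<in> entry K"
    using Min_in[OF fin ne] h by (auto simp: entry_def hatW_shift)
  then show "h \<in> hits (entry K)" using h by (auto simp: hits_def)
qed

abbreviation idx :: "'v \<Rightarrow> nat" where "idx \<equiv> to_nat_on (UNIV :: 'v set)"

lemma idx_eq_iff: "idx x = idx y \<longleftrightarrow> x = y"
  using inj_on_to_nat_on[OF countable_vertices] by (auto simp: inj_on_def)

text \<open>The paths for which time 0 is the first visit to the vertex of smallest index among all visited
vertices. Every orbit contains exactly one of them.\<close>

definition least_visit :: "'v path set" where
  "least_visit = {h \<in> H. \<forall>k. idx (fst h 0) < idx (fst h k) \<or> (fst h k = fst h 0 \<and> 0 \<le> k)}"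

lemma section_least_visit: "section_of_shift least_visit"
  unfolding section_of_shift_def
proof (intro conjI ballI allI impI)
  have "{h \<in> space path_space. idx (fst h 0) < idx (fst h k) \<or> (fst h k = fst h 0 \<and> 0 \<le> k)} \<in> sets path_space" for k
    by (rule measurable_vertex_pair) simp_all
  then have "{h \<in> space path_space. \<forall>k. idx (fst h 0) < idx (fst h k) \<or> (fst h k = fst h 0 \<and> 0 \<le> k)} \<in> sets path_space"
    by (rule sets.sets_Collect_countable_All)
  moreover have "least_visit = H \<inter> {h \<in> space path_space. \<forall>k. idx (fst h 0) < idx (fst h k) \<or> (fst h k = fst h 0 \<and> 0 \<le> k)}"
    by (auto simp: least_visit_def hatW_in_space)
  ultimately show "least_visit \<in> sets (hatW_space E UNIV)"
    using hatW_sets by (auto simp: hatW_space_sets_iff)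
  fix h m assume h: "h \<in> least_visit" and m: "time_shift m h \<in> least_visit"
  have 1: "idx (fst h 0) < idx (fst h m) \<or> (fst h m = fst h 0 \<and> 0 \<le> m)"
    using h unfolding least_visit_def by blast
  have "idx (fst (time_shift m h) 0) < idx (fst (time_shift m h) (- m)) \<or>
      (fst (time_shift m h) (- m) = fst (time_shift m h) 0 \<and> 0 \<le> - m)"
    using m unfolding least_visit_def by blast
  then have 2: "idx (fst h m) < idx (fst h 0) \<or> (fst h 0 = fst h m \<and> 0 \<le> - m)" by simp
  show "m = 0" using 1 2 by auto
qed

lemma hits_least_visit: "hits least_visit = H"
proof (intro set_eqI iffI)
  fix h assume h: "h \<in> H"
  \<comment> \<open>by injectivity of the index, the vertex of smallest index is unique; its first visit is the new origin\<close>
  obtain k0 where k0: "\<And>k. idx (fst h k0) \<le> idx (fst h k)"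
    using ex_has_least_nat[of "\<lambda>_. True" 0 "\<lambda>k. idx (fst h k)"] by auto
  let ?T = "{k. fst h k = fst h k0}"
  have fin: "finite ?T" using h by (simp add: two_sided_hatW_alt)
  have M: "Min ?T \<in> ?T" using fin by (intro Min_in) auto
  have "idx (fst h (Min ?T)) < idx (fst h (k + Min ?T)) \<or>
      (fst h (k + Min ?T) = fst h (Min ?T) \<and> 0 \<le> k)" for k
  proof (cases "idx (fst h k0) = idx (fst h (k + Min ?T))")
    case True
    then have "k + Min ?T \<in> ?T" by (simp add: idx_eq_iff)
    then have "Min ?T \<le> k + Min ?T" by (rule Min_le[OF fin])
    then show ?thesis using True M by (simp add: idx_eq_iff)
  next
    case False then show ?thesis using k0[of "k + Min ?T"] M by simp
  qed
  then have "time_shift (Min ?T) h \<in> least_visit" using h by (simp add: least_visit_def hatW_shift)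
  then show "h \<in> hits least_visit" using h by (auto simp: hits_def)
qed (simp add: hits_def)

definition nu :: "'v path set measure" where
  "nu = distr (density mu_hat (indicator least_visit)) (hatW_star_space E) (proj_star E)"

lemma emeasure_nu:
  assumes A: "A \<in> sets (hatW_star_space E)" shows "emeasure nu A = emeasure mu_hat (least_visit \<inter> star_preimage A)"
proof -
  have b: "least_visit \<in> sets mu_hat" using section_least_visit by (simp add: section_of_shift_def sets_mu_hat)
  have p: "star_preimage A \<in> sets mu_hat" using A by (simp add: star_sets_iff sets_mu_hat)
  have "emeasure nu A = emeasure (density mu_hat (indicator least_visit)) (star_preimage A)"
    unfolding nu_def star_preimage_def using A
    by (subst emeasure_distr) (auto intro!: measurable_proj simp: sets_mu_hat space_mu_hat)
  then show ?thesis using emeasure_restricted[OF b p] by simp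
qed

lemma emeasure_image_hatQ:
  assumes K: "finite K" and A: "A \<in> sets (hatW_star_space E)"
  shows "emeasure (image_hatQ E C u \<beta> K) A = emeasure mu_hat (entry K \<inter> star_preimage A)"
proof -
  have "emeasure (image_hatQ E C u \<beta> K) A = emeasure (entrance_measure K) (star_preimage A)"
    unfolding hatQ_eq_entrance_measure[OF K] star_preimage_def using A
    by (subst emeasure_distr) (auto intro!: measurable_proj simp: sets_entrance_measure space_entrance_measure)
  then show ?thesis using A by (simp add: emeasure_entrance_measure star_sets_iff)
qed

text \<open>With \<open>least_visit\<close> meeting all orbits and \<open>entry K\<close> meeting those that visit \<open>K\<close>, this is the
transfer between the two sections for the shift-invariant set \<open>star_preimage A\<close>.\<close>

lemma density_nu:
  assumes K: "finite K"
  shows "density nu (indicator (hatW_star_K E K)) = image_hatQ E C u \<beta> K"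
proof (rule measure_eqI)
  have sn: "sets nu = sets (hatW_star_space E)" by (simp add: nu_def)
  show "sets (density nu (indicator (hatW_star_K E K))) = sets (image_hatQ E C u \<beta> K)"
    by (simp add: sn)
  fix A assume "A \<in> sets (density nu (indicator (hatW_star_K E K)))"
  then have A: "A \<in> sets (hatW_star_space E)" by (simp add: sn)
  then have pA: "star_preimage A \<in> sets (hatW_space E UNIV)" by (simp add: star_sets_iff)
  have "emeasure (density nu (indicator (hatW_star_K E K))) A = emeasure nu (hatW_star_K E K \<inter> A)"
    using A star_K_sets[of K] by (intro emeasure_restricted) (simp_all add: sn)
  also have "\<dots> = emeasure mu_hat (least_visit \<inter> star_preimage (hatW_star_K E K \<inter> A))"
    using A star_K_sets[of K] by (intro emeasure_nu) auto
  also have "least_visit \<inter> star_preimage (hatW_star_K E K \<inter> A) = least_visit \<inter> star_preimage A \<inter> hits (entry K)"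
    unfolding hits_entry[OF K] star_preimage_star_K[symmetric] by (auto simp: star_preimage_def)
  also have "emeasure mu_hat \<dots> = emeasure mu_hat (entry K \<inter> star_preimage A \<inter> hits least_visit)"
    by (rule section_transfer[OF section_least_visit section_entry pA star_preimage_shift])
  also have "entry K \<inter> star_preimage A \<inter> hits least_visit = entry K \<inter> star_preimage A"
    unfolding hits_least_visit by (auto simp: star_preimage_def)
  also have "emeasure mu_hat (entry K \<inter> star_preimage A) = emeasure (image_hatQ E C u \<beta> K) A"
    using emeasure_image_hatQ[OF K A] by simp
  finally show "emeasure (density nu (indicator (hatW_star_K E K))) A = emeasure (image_hatQ E C u \<beta> K) A" .
qed

text \<open>The extra vertex keeps the sets nonempty.\<close>

definition exhaust :: "nat \<Rightarrow> 'v set" where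
  "exhaust n = {x. idx x \<le> n} \<union> {undefined}"

lemma finite_exhaust: "finite (exhaust n)"
proof -
  have "inj idx" using inj_on_to_nat_on[OF countable_vertices] .
  from finite_vimageI[OF finite_atMost[of n] this] show ?thesis
    by (simp add: exhaust_def vimage_def)
qed

lemma star_K_exhaust: "incseq (\<lambda>n. hatW_star_K E (exhaust n))" "(\<Union>n. hatW_star_K E (exhaust n)) = hatW_star E"
proof -
  have exhaust_mono: "exhaust m \<subseteq> exhaust n" if "m \<le> n" for m n
    using that by (auto simp: exhaust_def)
  have "hatW_star_K E K \<subseteq> hatW_star_K E K'" if "K \<subseteq> K'" for K K'
    using that by (auto simp: hatW_star_K_def)
  then show "incseq (\<lambda>n. hatW_star_K E (exhaust n))"
    unfolding incseq_def by (simp add: exhaust_mono)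
  have "proj_star E h \<in> (\<Union>n. hatW_star_K E (exhaust n))" if "h \<in> H" for h
    using star_K_iff[OF that, of "exhaust (idx (fst h 0))"] by (auto simp: exhaust_def)
  then show "(\<Union>n. hatW_star_K E (exhaust n)) = hatW_star E"
    by (auto simp: hatW_star_image hatW_star_K_def)
qed

text \<open>The orbits that visit \<open>exhaust n\<close> increase to the whole space, and on each of them the measure is
prescribed. Uniqueness and the supremum formula are both instances.\<close>

lemma determined_by_restrictions:
  assumes s: "sets N = sets (hatW_star_space E)"
    and d: "\<And>K. finite K \<Longrightarrow> K \<noteq> {} \<Longrightarrow> density N (indicator (hatW_star_K E K)) = image_hatQ E C u \<beta> K"
    and A: "A \<in> sets (hatW_star_space E)"
  shows "emeasure N A = (SUP K\<in>{K. finite K \<and> K \<noteq> {}}. emeasure (image_hatQ E C u \<beta> K) A)"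
proof -
  have r: "emeasure (image_hatQ E C u \<beta> K) A = emeasure N (hatW_star_K E K \<inter> A)"
    if "finite K" "K \<noteq> {}" for K
    unfolding d[OF that, symmetric] using A star_K_sets[of K] by (intro emeasure_restricted) (simp_all add: s)
  have m: "hatW_star_K E K \<inter> A \<in> sets N" for K using A star_K_sets[of K] by (auto simp: s)
  show ?thesis
  proof (rule antisym)
    have "A = (\<Union>n. hatW_star_K E (exhaust n) \<inter> A)"
      using star_K_exhaust(2) sets.sets_into_space[OF A] by auto
    then have "emeasure N A = emeasure N (\<Union>n. hatW_star_K E (exhaust n) \<inter> A)" by simp
    also have "\<dots> = (SUP n. emeasure N (hatW_star_K E (exhaust n) \<inter> A))"
      using m star_K_exhaust(1) by (intro SUP_emeasure_incseq[symmetric]) (auto simp: incseq_def)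
    also have "\<dots> = (SUP n. emeasure (image_hatQ E C u \<beta> (exhaust n)) A)"
      by (intro SUP_cong refl r[symmetric] finite_exhaust) (simp add: exhaust_def)
    also have "\<dots> \<le> (SUP K\<in>{K. finite K \<and> K \<noteq> {}}. emeasure (image_hatQ E C u \<beta> K) A)"
    proof (rule SUP_mono)
      fix n
      have "exhaust n \<in> {K. finite K \<and> K \<noteq> {}}" using finite_exhaust by (simp add: exhaust_def)
      then show "\<exists>K\<in>{K. finite K \<and> K \<noteq> {}}. emeasure (image_hatQ E C u \<beta> (exhaust n)) A \<le>
          emeasure (image_hatQ E C u \<beta> K) A" by (rule bexI[rotated]) simp
    qed
    finally show "emeasure N A \<le> (SUP K\<in>{K. finite K \<and> K \<noteq> {}}. emeasure (image_hatQ E C u \<beta> K) A)" .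
    show "(SUP K\<in>{K. finite K \<and> K \<noteq> {}}. emeasure (image_hatQ E C u \<beta> K) A) \<le> emeasure N A"
      using A by (intro SUP_least) (auto simp: r s intro!: emeasure_mono)
  qed
qed

text \<open>Paths in \<open>entry K\<close> visit \<open>K\<close>, so this is the total mass.\<close>

lemma emeasure_image_hatQ_star_K:
  assumes K: "finite K"
  shows "emeasure (image_hatQ E C u \<beta> K) (hatW_star_K E K) = emeasure (entrance_measure K) H"
proof -
  have "entry K \<inter> star_preimage (hatW_star_K E K) = entry K \<inter> H"
    by (auto simp: star_preimage_star_K entry_def)
  then show ?thesis
    using emeasure_image_hatQ[OF K star_K_sets] sets.top[of "hatW_space E UNIV"] by (simp add: emeasure_entrance_measure)
qed

lemma image_hatQ_star_K_finite:
  "finite K \<Longrightarrow> emeasure (image_hatQ E C u \<beta> K) (hatW_star_K E K) < \<infinity>"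
  using entrance_measure_finite emeasure_image_hatQ_star_K by simp

text \<open>The total mass dominates that of the paths with \<open>w(0) = x\<close>, for a vertex \<open>x\<close> of \<open>K\<close> from
which escape has positive probability.\<close>

lemma image_hatQ_star_K_pos:
  assumes tr: "transient_law (law x0)" and K: "finite K" "K \<noteq> {}"
  shows "0 < emeasure (image_hatQ E C u \<beta> K) (hatW_star_K E K)"
proof -
  obtain x where x: "x \<in> K" "0 < emeasure (law x) (escape_set E K)" using escape_pos[OF tr K] by blast
  have T: "hatW E {1..} \<in> sets (hatW_space E {1..})" using sets.top[of "hatW_space E {1..}"] by simp
  have fut: "future h \<in> hatW E {1..}" if h: "h \<in> hatW E {0..}" for h
  proof -
    have f: "finite {k \<in> {0..}. fst h k = j}" for j using h by (simp add: hatW_alt)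
    have "{k \<in> {1..}. fst (future h) k = j} \<subseteq> {k \<in> {0..}. fst h k = j}" for j
      by (auto simp: future_apply)
    then have "finite {k \<in> {1..}. fst (future h) k = j}" for j by (rule finite_subset[OF _ f])
    moreover have "{fst (future h) k, fst (future h) (k + 1)} \<in> E" if "k \<in> {1..}" for k
      using that h by (simp add: hatW_alt future_apply)
    ultimately show ?thesis
      using measurable_space[OF measurable_future_one_sided hatW_in_space[OF h]] by (simp add: hatW_alt)
  qed
  have s1: "{h \<in> hatW E {0..}. future h \<in> hatW E {1..} \<and> h \<in> escape_set E K} = escape_set E K"
    using fut by (auto simp: escape_set_alt)
  have s2: "{h \<in> hatW E {0..}. future h \<in> hatW E {1..}} = hatW E {0..}" using fut by auto
  have "emeasure (law x) (escape_set E K) \<le> emeasure (law x) (hatW E {0..})"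
    by (intro emeasure_mono) (auto simp: escape_set_alt sets_law hatW_sets)
  then have pos: "0 < emeasure (law x) (hatW E {0..})" using x(2) by order
  let ?D = "{h \<in> H. past h \<in> hatW E {1..} \<and> fst h 0 = x \<and> 0 \<le> snd h 0 \<and> future h \<in> hatW E {1..}}"
  have "0 < emeasure (entrance_measure K) ?D"
    unfolding emeasure_entrance_measure_event[OF order_refl T T] s1 s2 using x(2) pos c_pos[of x]
    by (simp add: ennreal_zero_less_mult_iff)
  also have "\<dots> \<le> emeasure (entrance_measure K) H"
    by (intro emeasure_mono) (auto simp: sets_entrance_measure hatW_space_sets_iff hatW_sets)
  finally show "0 < emeasure (image_hatQ E C u \<beta> K) (hatW_star_K E K)"
    unfolding emeasure_image_hatQ_star_K[OF K(1)] .
qed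

lemma sigma_finite_nu: "sigma_finite_measure nu"
proof
  have sn: "sets nu = sets (hatW_star_space E)" by (simp add: nu_def)
  have "emeasure nu (hatW_star_K E (exhaust n)) \<noteq> \<infinity>" for n
  proof -
    have "emeasure nu (hatW_star_K E (exhaust n)) =
        emeasure (density nu (indicator (hatW_star_K E (exhaust n)))) (hatW_star_K E (exhaust n))"
      using star_K_sets[of "exhaust n"] by (subst emeasure_restricted) (simp_all add: sn)
    then show ?thesis
      unfolding density_nu[OF finite_exhaust]
      using image_hatQ_star_K_finite[OF finite_exhaust[of n]] by simp
  qed
  then show "\<exists>A. countable A \<and> A \<subseteq> sets nu \<and> \<Union> A = space nu \<and> (\<forall>a\<in>A. emeasure nu a \<noteq> \<infinity>)"
    using star_K_exhaust(2) star_K_sets sets_eq_imp_space_eq[OF sn]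
    by (intro exI[of _ "range (\<lambda>n. hatW_star_K E (exhaust n))"]) (auto simp: sn)
qed

end

theorem theorem1p3:
  fixes E :: "'v set set" and C :: "'v \<Rightarrow> 'v \<Rightarrow> real" and vo :: 'v
    and \<beta> u :: "'v \<Rightarrow> real"
  assumes "conductance_graph E C"
    and "\<And>x. \<beta> x > 0"
    and "u vo = 0"
    and "\<And>x. \<beta> x = 1 / 2 * (\<Sum>\<^sub>\<infinity>y\<in>UNIV. C x y * exp (u y - u x))"
    and "transient_law (jump_law C u \<beta> vo)"
  shows "\<exists>\<nu> :: 'v path set measure.
     (sets \<nu> = sets (hatW_star_space E) \<and>
      (\<forall>K. finite K \<and> K \<noteq> {} \<longrightarrow>
         density \<nu> (indicator (hatW_star_K E K)) = image_hatQ E C u \<beta> K)) \<and>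
     (\<forall>\<nu>'. sets \<nu>' = sets (hatW_star_space E) \<and>
           (\<forall>K. finite K \<and> K \<noteq> {} \<longrightarrow>
              density \<nu>' (indicator (hatW_star_K E K)) = image_hatQ E C u \<beta> K) \<longrightarrow> \<nu>' = \<nu>) \<and>
     sigma_finite_measure \<nu> \<and>
     (\<forall>A\<in>sets (hatW_star_space E).
        emeasure \<nu> A = (SUP K\<in>{K. finite K \<and> K \<noteq> {}}. emeasure (image_hatQ E C u \<beta> K) A)) \<and>
     (\<forall>K. finite K \<and> K \<noteq> {} \<longrightarrow>
        0 < emeasure \<nu> (hatW_star_K E K) \<and>
        emeasure \<nu> (hatW_star_K E K) = emeasure (image_hatQ E C u \<beta> K) (hatW_star_K E K) \<and>
        emeasure (image_hatQ E C u \<beta> K) (hatW_star_K E K) < \<infinity>)"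
proof -
  interpret jump_process E C \<beta> u by unfold_locales (rule assms)+
  have tr: "transient_law (law vo)" using assms(5) by (simp add: jump_law_eq_law)
  have sn: "sets nu = sets (hatW_star_space E)" by (simp add: nu_def)
  have nu: "density nu (indicator (hatW_star_K E K)) = image_hatQ E C u \<beta> K" if "finite K" for K
    using density_nu[OF that] .
  have nu_K: "emeasure nu (hatW_star_K E K) = emeasure (image_hatQ E C u \<beta> K) (hatW_star_K E K)"
    if "finite K" for K
    unfolding nu[OF that, symmetric] using star_K_sets[of K] by (subst emeasure_restricted) (simp_all add: sn)
  show ?thesis
  proof (intro exI[of _ nu] conjI allI impI ballI)
    fix \<nu>' :: "'v path set measure"
    assume n: "sets \<nu>' = sets (hatW_star_space E) \<and> (\<forall>K. finite K \<and> K \<noteq> {} \<longrightarrow>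
              density \<nu>' (indicator (hatW_star_K E K)) = image_hatQ E C u \<beta> K)"
    show "\<nu>' = nu"
    proof (rule measure_eqI)
      fix A assume "A \<in> sets \<nu>'"
      then have A: "A \<in> sets (hatW_star_space E)" using n by simp
      show "emeasure \<nu>' A = emeasure nu A"
        using determined_by_restrictions[of \<nu>' A] determined_by_restrictions[OF sn nu A] n A by simp
    qed (use n sn in simp)
  qed (use sn nu sigma_finite_nu determined_by_restrictions[OF sn nu] nu_K image_hatQ_star_K_pos[OF tr] image_hatQ_star_K_finite in auto)
qed

end
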